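(* Let $d,n\ge 1$ be integers, let $K_1,\ldots,K_n\in(0,\infty)$, and let $X_1,\ldots,X_n$ be independent random vectors in $\mathbb{R}^d$ with $M(X_i)\le K_i$ for each $i$. Let $U_1,\ldots,U_n$ be independent random vectors in $\mathbb{R}^d$ such that $U_i$ has density equal to $K_i$ on a ball centered at the origin (necessarily of Lebesgue measure $1/K_i$) and equal to $0$ elsewhere. Then for every measurable set $S\subseteq\mathbb{R}^d$, $$\mathbb{P}\left(X_1+\cdots+X_n\in S\right)\le \mathbb{P}\left(U_1+\cdots+U_n\in B\right),$$ where $B$ is the ball centered at the origin such that $\mu(B)=\mu(S)$.
   Context: $\mu$ denotes Lebesgue measure on $\mathbb{R}^d$, and balls are Euclidean. For a random vector $X$ in $\mathbb{R}^d$ with a density $p$ with respect to $\mu$, $M(X)=\operatorname{ess\,sup} p:=\sup\{\epsilon:\mu(\{t:p(t)>\epsilon\})>0\}$. If the distribution of $X$ is not absolutely continuous with respect to $\mu$, then $M(X):=\infty$. If $\mu(S)=\infty$, the ball $B$ is understood to be $\mathbb{R}^d$. *)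

theory Defs
  imports "HOL-Probability.Probability"
begin

definition ess_sup_density :: "('a::euclidean_space \<Rightarrow> ennreal) \<Rightarrow> ennreal" where
  "ess_sup_density p = Sup {\<epsilon>. emeasure lborel {t. p t > \<epsilon>} > 0}"

(* The density is taken to be the Radon-Nikodym derivative of the law of X; by the lemma
   max_density_distributed below, any other version of the density gives the same value. *)
definition max_density :: "'w measure \<Rightarrow> ('w \<Rightarrow> 'a::euclidean_space) \<Rightarrow> ennreal" where
  "max_density M X =
     (if absolutely_continuous lborel (distr M lborel X)
      then ess_sup_density (RN_deriv lborel (distr M lborel X))
      else \<infinity>)"

lemma ess_sup_density_cong_AE:
  fixes p q :: "'a::euclidean_space \<Rightarrow> ennreal"
  assumes [measurable]: "p \<in> borel_measurable lborel" "q \<in> borel_measurable lborel"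
    and ae: "AE t in lborel. p t = q t"
  shows "ess_sup_density p = ess_sup_density q"
proof -
  have "emeasure lborel {t. p t > e} = emeasure lborel {t. q t > e}" for e
  proof (rule emeasure_eq_AE)
    show "AE t in lborel. t \<in> {t. p t > e} \<longleftrightarrow> t \<in> {t. q t > e}"
      using ae by eventually_elim simp
    have "{t \<in> space lborel. p t > e} \<in> sets lborel" "{t \<in> space lborel. q t > e} \<in> sets lborel"
      by measurable
    then show "{t. p t > e} \<in> sets lborel" "{t. q t > e} \<in> sets lborel" by simp_all
  qed
  then show ?thesis by (simp add: ess_sup_density_def)
qed

lemma max_density_distributed:
  fixes X :: "'w \<Rightarrow> 'a::euclidean_space"
  assumes "distributed M lborel X p"
  shows "max_density M X = ess_sup_density p"
proof -
  have p[measurable]: "p \<in> borel_measurable lborel"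
    and eq: "distr M lborel X = density lborel p"
    using assms by (auto simp: distributed_def)
  have "absolutely_continuous lborel (distr M lborel X)"
    unfolding eq by (rule absolutely_continuousI_density) simp
  moreover have "AE t in lborel. p t = RN_deriv lborel (distr M lborel X) t"
    using sigma_finite_measure.RN_deriv_unique[OF sigma_finite_lborel p eq[symmetric]] .
  ultimately show ?thesis
    unfolding max_density_def
    by (simp add: ess_sup_density_cong_AE[OF p borel_measurable_RN_deriv])
qed

end

theory Submission
  imports Defs
begin

text \<open>
  The proof is by induction on the number of summands, for expectations of test functions instead of
  probabilities of sets. Say that a function \<open>g\<close> dominates \<open>f\<close> if every set captures at most as much
  mass of \<open>f\<close> as the centred ball of the same measure captures of \<open>g\<close>. If \<open>p'\<close> is radially decreasing
  and dominates \<open>p\<close>, then the expectation of \<open>p\<close> at the sum of the \<open>X i\<close> is at most that of \<open>p'\<close> at the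
  sum of the \<open>U i\<close> (\<open>nn_integral_sum_le\<close>); the theorem is the case of the indicators of \<open>S\<close> and \<open>B\<close>. In the
  induction step the density of one summand is convolved into the test function, so that the point is
  that domination survives convolution of \<open>p\<close> with a density bounded by \<open>K\<close> and of \<open>p'\<close> with the uniform
  density \<open>K\<close> on a ball (\<open>dominated_conv\<close>), and that radial decrease survives as well
  (\<open>radial_decreasing_conv\<close>). By duality and a Hardy--Littlewood argument
  (\<open>nn_integral_mult_le_of_dominated\<close>) domination reduces to the Riesz rearrangement inequality for three functions
  with values in the unit interval (\<open>riesz_rearrangement\<close>).

  On the line this inequality has a short proof (\<open>conv_excess_le\<close>): cutting the lowest part of mass \<open>t\<close> off
  the first function and the highest part of mass \<open>t\<close> off the second lowers their convolution by at most
  \<open>t\<close> everywhere, which bounds the mass of the convolution above height \<open>t\<close>; centred intervals attain the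
  resulting bound. Slicing along a direction then shows that Steiner symmetrization does not decrease
  the Riesz functional (\<open>riesz_steiner\<close>). Finally, symmetrization in a suitable direction increases the overlap
  of a set with its ball by an amount that is bounded below in terms of the deviation from the ball, and
  does not decrease the overlaps of the other two sets. Hence a triple of nearly maximal overlap consists
  of almost balls (\<open>approximate_by_symmetrization\<close>).
\<close>

section \<open>Invariance of Lebesgue measure and slicing along a direction\<close>

lemma lborel_Fubini:
  fixes f :: "'a::euclidean_space \<Rightarrow> 'b::euclidean_space \<Rightarrow> ennreal"
  assumes "case_prod f \<in> borel_measurable (borel \<Otimes>\<^sub>M borel)"
  shows "(\<integral>\<^sup>+x. \<integral>\<^sup>+y. f x y \<partial>lborel \<partial>lborel) = (\<integral>\<^sup>+y. \<integral>\<^sup>+x. f x y \<partial>lborel \<partial>lborel)"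
  by (rule lborel_pair.Fubini'[symmetric])
     (use assms in \<open>simp add: measurable_def space_pair_measure cong: sets_pair_measure_cong\<close>)

lemma nn_integral_lborel_translate:
  fixes f :: "'a::euclidean_space \<Rightarrow> ennreal"
  assumes [measurable]: "f \<in> borel_measurable borel"
  shows "(\<integral>\<^sup>+x. f (x + a) \<partial>lborel) = (\<integral>\<^sup>+x. f x \<partial>lborel)"
proof -
  have "(\<integral>\<^sup>+x. f x \<partial>lborel) = (\<integral>\<^sup>+x. f x \<partial>distr lborel borel ((+) a))"
    by (simp only: lborel_distr_plus)
  also have "\<dots> = (\<integral>\<^sup>+x. f (x + a) \<partial>lborel)"
    by (subst nn_integral_distr) (auto simp: add.commute)
  finally show ?thesis by simp
qed

lemma nn_integral_lborel_reflect:
  fixes f :: "'a::euclidean_space \<Rightarrow> ennreal"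
  assumes [measurable]: "f \<in> borel_measurable borel"
  shows "(\<integral>\<^sup>+x. f (a - x) \<partial>lborel) = (\<integral>\<^sup>+x. f x \<partial>lborel)"
  by (subst (2) lborel_affine[of "-1" a]) 
     (auto simp: density_1 nn_integral_distr one_ennreal_def[symmetric])

text \<open>Integration along the lines parallel to \<open>u\<close>, without choosing coordinates: the slab
  \<open>0 \<le> x \<bullet> u \<le> 1\<close> meets each such line in a segment of length one.\<close>

lemma nn_integral_slices:
  fixes f :: "'a::euclidean_space \<Rightarrow> ennreal"
  assumes [measurable]: "f \<in> borel_measurable borel" and u: "norm u = 1"
  shows "(\<integral>\<^sup>+x. f x \<partial>lborel) =
    (\<integral>\<^sup>+x. indicator {0..1} (x \<bullet> u) * (\<integral>\<^sup>+t. f (x + t *\<^sub>R u) \<partial>lborel) \<partial>lborel)"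
proof -
  have uu: "u \<bullet> u = 1" using u by (simp add: norm_eq_1)
  have "(\<integral>\<^sup>+x. indicator {0..1} (x \<bullet> u) * (\<integral>\<^sup>+t. f (x + t *\<^sub>R u) \<partial>lborel) \<partial>lborel)
      = (\<integral>\<^sup>+x. (\<integral>\<^sup>+t. indicator {0..1::real} (x \<bullet> u) * f (x + t *\<^sub>R u) \<partial>lborel) \<partial>lborel)"
    by (intro nn_integral_cong nn_integral_cmult[symmetric]) measurable
  also have "\<dots> = (\<integral>\<^sup>+t. (\<integral>\<^sup>+x. indicator {0..1::real} (x \<bullet> u) * f (x + t *\<^sub>R u) \<partial>lborel) \<partial>lborel)"
    by (rule lborel_Fubini) measurable
  also have "\<dots> = (\<integral>\<^sup>+t. (\<integral>\<^sup>+x. indicator {0..1::real} ((x - t *\<^sub>R u) \<bullet> u) * f x \<partial>lborel) \<partial>lborel)"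
  proof (rule nn_integral_cong)
    fix t
    show "(\<integral>\<^sup>+x. indicator {0..1::real} (x \<bullet> u) * f (x + t *\<^sub>R u) \<partial>lborel)
      = (\<integral>\<^sup>+x. indicator {0..1::real} ((x - t *\<^sub>R u) \<bullet> u) * f x \<partial>lborel)"
      using nn_integral_lborel_translate[of "\<lambda>x. indicator {0..1::real} ((x - t *\<^sub>R u) \<bullet> u) * f x" "t *\<^sub>R u"]
      by simp
  qed
  also have "\<dots> = (\<integral>\<^sup>+x. (\<integral>\<^sup>+t. indicator {0..1::real} ((x - t *\<^sub>R u) \<bullet> u) * f x \<partial>lborel) \<partial>lborel)"
    by (rule lborel_Fubini) measurable
  also have "\<dots> = (\<integral>\<^sup>+x. f x \<partial>lborel)"
  proof (rule nn_integral_cong)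
    fix x
    have "(\<integral>\<^sup>+t. indicator {0..1::real} ((x - t *\<^sub>R u) \<bullet> u) * f x \<partial>lborel)
       = (\<integral>\<^sup>+t. indicator {x \<bullet> u - 1 .. x \<bullet> u} t \<partial>lborel) * f x"
      by (subst nn_integral_multc[symmetric])
         (auto intro!: nn_integral_cong simp: indicator_def inner_diff_left uu)
    then show "(\<integral>\<^sup>+t. indicator {0..1::real} ((x - t *\<^sub>R u) \<bullet> u) * f x \<partial>lborel) = f x"
      by simp
  qed
  finally show ?thesis by simp
qed

lemma norm_add_unit_vector:
  fixes u w :: "'a::real_inner"
  assumes "norm u = 1"
  shows "(norm (w + s *\<^sub>R u))\<^sup>2 = (norm w)\<^sup>2 + 2 * s * (w \<bullet> u) + s\<^sup>2"
  using assms unfolding power2_norm_eq_inner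
  by (simp add: norm_eq_1 inner_add_left inner_add_right inner_commute power2_eq_square)

lemma nn_integral_hyperplane_reflection:
  fixes f :: "'a::euclidean_space \<Rightarrow> ennreal"
  assumes [measurable]: "f \<in> borel_measurable borel" and u: "norm u = 1"
  shows "(\<integral>\<^sup>+x. f (x + (2 * (\<kappa> - x \<bullet> u)) *\<^sub>R u) \<partial>lborel) = (\<integral>\<^sup>+x. f x \<partial>lborel)"
proof -
  have uu: "u \<bullet> u = 1" using u by (simp add: norm_eq_1)
  have "(\<integral>\<^sup>+t. f ((x + t *\<^sub>R u) + (2 * (\<kappa> - (x + t *\<^sub>R u) \<bullet> u)) *\<^sub>R u) \<partial>lborel)
      = (\<integral>\<^sup>+t. f (x + t *\<^sub>R u) \<partial>lborel)" for x
  proof -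
    have "(x + t *\<^sub>R u) + (2 * (\<kappa> - (x + t *\<^sub>R u) \<bullet> u)) *\<^sub>R u
        = x + (2 * (\<kappa> - x \<bullet> u) - t) *\<^sub>R u" for t
      by (simp add: inner_add_left uu algebra_simps flip: scaleR_add_left)
    note this [simp]
    show ?thesis
      using nn_integral_lborel_reflect[of "\<lambda>t. f (x + t *\<^sub>R u)" "2 * (\<kappa> - x \<bullet> u)"]
      by (simp del: distrib_left_numeral right_diff_distrib_numeral)
  qed
  then show ?thesis
    by (subst (1 2) nn_integral_slices[OF _ u]) simp_all
qed

section \<open>Convolution and centred balls\<close>

text \<open>Convolution of nonnegative functions with respect to Lebesgue measure.\<close>

definition conv :: "('a::euclidean_space \<Rightarrow> ennreal) \<Rightarrow> ('a \<Rightarrow> ennreal) \<Rightarrow> 'a \<Rightarrow> ennreal" where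
  "conv f g z = (\<integral>\<^sup>+x. f x * g (z - x) \<partial>lborel)"

lemma measurable_conv [measurable]:
  assumes [measurable]: "f \<in> borel_measurable borel" "g \<in> borel_measurable borel"
  shows "conv f g \<in> borel_measurable borel"
  unfolding conv_def by measurable

lemma nn_integral_conv_mult:
  fixes f g h :: "'a::euclidean_space \<Rightarrow> ennreal"
  assumes [measurable]: "f \<in> borel_measurable borel" "g \<in> borel_measurable borel" "h \<in> borel_measurable borel"
  shows "(\<integral>\<^sup>+z. conv f g z * h z \<partial>lborel) = (\<integral>\<^sup>+x. f x * (\<integral>\<^sup>+y. g y * h (x + y) \<partial>lborel) \<partial>lborel)"
proof -
  have "(\<integral>\<^sup>+z. conv f g z * h z \<partial>lborel) = (\<integral>\<^sup>+z. \<integral>\<^sup>+x. f x * (g (z - x) * h z) \<partial>lborel \<partial>lborel)"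
    unfolding conv_def by (simp add: nn_integral_multc mult.assoc[symmetric])
  also have "\<dots> = (\<integral>\<^sup>+x. \<integral>\<^sup>+z. f x * (g (z - x) * h z) \<partial>lborel \<partial>lborel)"
    by (rule lborel_Fubini) measurable
  also have "\<dots> = (\<integral>\<^sup>+x. f x * (\<integral>\<^sup>+z. g (z - x) * h z \<partial>lborel) \<partial>lborel)"
    by (intro nn_integral_cong nn_integral_cmult) measurable
  also have "\<dots> = (\<integral>\<^sup>+x. f x * (\<integral>\<^sup>+y. g y * h (x + y) \<partial>lborel) \<partial>lborel)"
  proof (rule nn_integral_cong)
    fix x
    show "f x * (\<integral>\<^sup>+z. g (z - x) * h z \<partial>lborel) = f x * (\<integral>\<^sup>+y. g y * h (x + y) \<partial>lborel)"
      using nn_integral_lborel_translate[of "\<lambda>z. g (z - x) * h z" x] by (simp add: add.commute)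
  qed
  finally show ?thesis .
qed

lemma nn_integral_conv:
  fixes f g :: "'a::euclidean_space \<Rightarrow> ennreal"
  assumes [measurable]: "f \<in> borel_measurable borel" "g \<in> borel_measurable borel"
  shows "(\<integral>\<^sup>+z. conv f g z \<partial>lborel) = (\<integral>\<^sup>+x. f x \<partial>lborel) * (\<integral>\<^sup>+x. g x \<partial>lborel)"
  using nn_integral_conv_mult[of f g "\<lambda>_. 1"] by (simp add: nn_integral_multc)

text \<open>The adjoint of convolution by \<open>f\<close> is convolution by the reflection of \<open>f\<close>.\<close>

lemma nn_integral_conv_mult_shift:
  fixes f g h :: "'a::euclidean_space \<Rightarrow> ennreal"
  assumes [measurable]: "f \<in> borel_measurable borel" "g \<in> borel_measurable borel" "h \<in> borel_measurable borel"
  shows "(\<integral>\<^sup>+z. conv f g z * h z \<partial>lborel) = (\<integral>\<^sup>+y. g y * conv (\<lambda>x. f (- x)) h y \<partial>lborel)"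
proof -
  have "(\<integral>\<^sup>+z. conv f g z * h z \<partial>lborel) = (\<integral>\<^sup>+x. \<integral>\<^sup>+y. f x * (g y * h (x + y)) \<partial>lborel \<partial>lborel)"
    by (subst nn_integral_conv_mult) (simp_all add: nn_integral_cmult)
  also have "\<dots> = (\<integral>\<^sup>+y. \<integral>\<^sup>+x. f x * (g y * h (x + y)) \<partial>lborel \<partial>lborel)"
    by (rule lborel_Fubini) measurable
  also have "\<dots> = (\<integral>\<^sup>+y. g y * (\<integral>\<^sup>+x. f x * h (x + y) \<partial>lborel) \<partial>lborel)"
    by (subst nn_integral_cmult[symmetric]) (simp_all add: mult_ac)
  also have "\<dots> = (\<integral>\<^sup>+y. g y * conv (\<lambda>x. f (- x)) h y \<partial>lborel)"
  proof (rule nn_integral_cong)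
    fix y
    show "g y * (\<integral>\<^sup>+x. f x * h (x + y) \<partial>lborel) = g y * conv (\<lambda>x. f (- x)) h y"
      unfolding conv_def using nn_integral_lborel_reflect[of "\<lambda>x. f x * h (x + y)" 0]
      by (simp add: add.commute)
  qed
  finally show ?thesis .
qed

text \<open>The open ball about the origin with measure \<open>m\<close>; it is the whole space for \<open>m = \<infinity>\<close>.\<close>

definition centered_ball :: "ennreal \<Rightarrow> 'a::euclidean_space set" where
  "centered_ball m = {x. emeasure lborel (ball (0::'a) (norm x)) < m}"

lemma emeasure_ball_less_iff:
  fixes r s :: real
  assumes "0 \<le> r" "0 \<le> s"
  shows "emeasure lborel (ball (0::'a::euclidean_space) r) < emeasure lborel (ball (0::'a) s) \<longleftrightarrow> r < s"
proof -
  have "unit_ball_vol (real DIM('a)) > 0" by simp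
  then show ?thesis
    using assms power_mono_iff[of s r "DIM('a)"]
    by (auto simp: emeasure_ball ennreal_less_iff not_le[symmetric])
qed

lemma centered_ball_eq_ball:
  assumes "m = emeasure lborel (ball (0::'a::euclidean_space) r)" "0 \<le> r"
  shows "centered_ball m = ball (0::'a) r"
  using assms by (auto simp: centered_ball_def emeasure_ball_less_iff)

lemma centered_ball_top [simp]: "centered_ball \<top> = (UNIV :: 'a::euclidean_space set)"
  by (auto simp: centered_ball_def emeasure_ball)

lemma centered_ball_obtain:
  assumes "m \<noteq> \<infinity>"
  obtains r where "0 \<le> r" "centered_ball m = ball (0::'a::euclidean_space) r"
    "emeasure lborel (ball (0::'a) r) = m"
proof -
  define c where "c = unit_ball_vol (real DIM('a))"
  have c: "c > 0" by (simp add: c_def)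
  define r where "r = root DIM('a) (enn2real m / c)"
  have r: "0 \<le> r" using c by (simp add: r_def)
  have "c * r ^ DIM('a) = enn2real m"
    using c by (simp add: r_def real_root_pow_pos2)
  then have "emeasure lborel (ball (0::'a) r) = m"
    using r assms by (simp add: emeasure_ball c_def[symmetric] less_top)
  with r that show ?thesis by (metis centered_ball_eq_ball)
qed

lemma emeasure_centered_ball [simp]: "emeasure lborel (centered_ball m :: 'a::euclidean_space set) = m"
proof (cases "m = \<infinity>")
  case True then show ?thesis by (simp add: emeasure_lborel_UNIV)
next
  case False then show ?thesis by (metis centered_ball_obtain)
qed

lemma borel_centered_ball [measurable, simp]: "(centered_ball m :: 'a::euclidean_space set) \<in> sets borel"
proof (cases "m = \<infinity>")
  case False then show ?thesis by (metis centered_ball_obtain borel_open open_ball)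
next
  case True then show ?thesis by simp
qed

lemma centered_ball_mono: "m \<le> m' \<Longrightarrow> centered_ball m \<subseteq> centered_ball m'"
  by (auto simp: centered_ball_def)

lemma centered_ball_norm:
  fixes x y :: "'a::euclidean_space"
  shows "x \<in> centered_ball m \<Longrightarrow> norm y \<le> norm x \<Longrightarrow> y \<in> centered_ball m"
  using le_less_trans[OF emeasure_mono[of "ball 0 (norm y)" "ball 0 (norm x)" lborel]]
  by (simp add: centered_ball_def subset_ball)

lemma centered_ball_0 [simp]: "centered_ball 0 = {}"
  by (auto simp: centered_ball_def)

lemma centered_ball_real: "centered_ball m = {x::real. ennreal (2 * \<bar>x\<bar>) < m}"
  by (auto simp: centered_ball_def emeasure_ball)

section \<open>Radially decreasing functions\<close>

text \<open>Symmetric decreasing functions: the value depends only on the norm and does not increase with it.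
  Both requirements are contained in one monotonicity condition.\<close>

definition radial_decreasing :: "('a::euclidean_space \<Rightarrow> ennreal) \<Rightarrow> bool" where
  "radial_decreasing f \<longleftrightarrow> (\<forall>x y. norm x \<le> norm y \<longrightarrow> f y \<le> f x)"

lemma radial_decreasingD: "radial_decreasing f \<Longrightarrow> norm x \<le> norm y \<Longrightarrow> f y \<le> f x"
  by (auto simp: radial_decreasing_def)

lemma radial_decreasing_uminus: "radial_decreasing f \<Longrightarrow> f (- x) = f x"
  by (simp add: radial_decreasing_def order_antisym)

lemma radial_decreasing_centered_ball: "radial_decreasing (indicator (centered_ball m))"
  by (auto simp: radial_decreasing_def indicator_def dest: centered_ball_norm)

lemma radial_decreasing_cmult: "radial_decreasing f \<Longrightarrow> radial_decreasing (\<lambda>x. c * f x)"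
  by (auto simp: radial_decreasing_def intro: mult_left_mono)

lemma rearrangement_ennreal:
  fixes a b c d :: ennreal
  assumes "b \<le> a" "d \<le> c"
  shows "a * d + b * c \<le> a * c + b * d"
proof -
  obtain a' c' where a: "a = b + a'" "c = d + c'"
    using assms by (metis le_iff_add)
  have "a * d + b * c = b * d + b * d + a' * d + b * c'"
    by (simp add: a distrib_left distrib_right add_ac)
  also have "\<dots> \<le> a * c + b * d"
    by (simp add: a distrib_left distrib_right add_ac)
  finally show ?thesis .
qed

text \<open>For \<open>norm x \<le> norm y\<close> let \<open>\<sigma>\<close> be the reflection that exchanges \<open>x\<close> and \<open>y\<close>. Averaging the integrals
  for \<open>conv p q x\<close> and \<open>conv p q y\<close> over \<open>\<sigma>\<close> reduces the claim to a pointwise rearrangement of two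
  products: of \<open>z\<close> and \<open>\<sigma> z\<close>, the one on the side of \<open>x\<close> is at least as near as the other to \<open>x\<close> and to the
  origin.\<close>

lemma radial_decreasing_conv:
  fixes p q :: "'a::euclidean_space \<Rightarrow> ennreal"
  assumes [measurable]: "p \<in> borel_measurable borel" "q \<in> borel_measurable borel"
    and p: "radial_decreasing p" and q: "radial_decreasing q"
  shows "radial_decreasing (conv p q)"
  unfolding radial_decreasing_def
proof (intro allI impI)
  fix x y :: 'a assume xy: "norm x \<le> norm y"
  show "conv p q y \<le> conv p q x"
  proof (cases "x = y")
    case False
    define u where "u = (y - x) /\<^sub>R norm (y - x)"
    have u: "norm u = 1" using False by (simp add: u_def)
    then have uu: "u \<bullet> u = 1" by (simp add: norm_eq_1)
    define \<kappa> where "\<kappa> = ((x + y) /\<^sub>R 2) \<bullet> u"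
    define \<sigma> where "\<sigma> z = z + (2 * (\<kappa> - z \<bullet> u)) *\<^sub>R u" for z
    have [measurable]: "\<sigma> \<in> borel_measurable borel" unfolding \<sigma>_def by measurable
    define d where "d = norm (y - x)"
    have d: "d > 0" "y = x + d *\<^sub>R u" using False by (auto simp: d_def u_def)
    have \<kappa>: "\<kappa> = x \<bullet> u + d / 2"
      unfolding \<kappa>_def by (simp add: d(2) inner_add_left uu algebra_simps)
    have sh: "z - y = (z - x) + (- d) *\<^sub>R u" "\<sigma> z - x = (z - x) + (d - 2 * ((z - x) \<bullet> u)) *\<^sub>R u"
      "\<sigma> z - y = (z - x) + (- 2 * ((z - x) \<bullet> u)) *\<^sub>R u" for z
      by (simp_all add: d(2) \<sigma>_def \<kappa> inner_diff_left inner_add_left uu algebra_simps)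
    have nd: "(norm (\<sigma> z - x))\<^sup>2 = (norm (z - y))\<^sup>2" "(norm (\<sigma> z - y))\<^sup>2 = (norm (z - x))\<^sup>2" for z
      unfolding sh norm_add_unit_vector[OF u] by (simp_all add: uu power2_eq_square algebra_simps)
    then have nd': "norm (\<sigma> z - x) = norm (z - y)" "norm (\<sigma> z - y) = norm (z - x)" for z
      by (metis norm_ge_zero power2_eq_iff_nonneg)+
    have \<kappa>0: "0 \<le> \<kappa>"
    proof -
      have "(norm y)\<^sup>2 = (norm x)\<^sup>2 + 2 * d * \<kappa>"
        unfolding \<kappa> d(2) norm_add_unit_vector[OF u] by (simp add: uu power2_eq_square algebra_simps)
      moreover have "(norm x)\<^sup>2 \<le> (norm y)\<^sup>2" using xy by (simp add: power_mono)
      ultimately have "0 \<le> d * \<kappa>" by linarith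
      then show ?thesis using d(1) by (simp add: zero_le_mult_iff mult.commute)
    qed
    have ns: "(norm (\<sigma> z))\<^sup>2 = (norm z)\<^sup>2 + 4 * \<kappa> * (\<kappa> - z \<bullet> u)" for z
      unfolding \<sigma>_def norm_add_unit_vector[OF u] by (simp add: uu power2_eq_square algebra_simps)
    have nx: "(norm (z - y))\<^sup>2 = (norm (z - x))\<^sup>2 + 2 * d * (\<kappa> - z \<bullet> u)" for z
      unfolding sh(1) norm_add_unit_vector[OF u] \<kappa>
      by (simp add: inner_diff_left power2_eq_square algebra_simps)
    have conv_alt: "conv p q w = (\<integral>\<^sup>+z. p z * q (z - w) \<partial>lborel)" for w
      unfolding conv_def using radial_decreasing_uminus[OF q, of "_ - _"] by simp
    have reflected: "(\<integral>\<^sup>+z. p (\<sigma> z) * q (\<sigma> z - w) \<partial>lborel) = conv p q w" for w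
      unfolding conv_alt \<sigma>_def
      by (rule nn_integral_hyperplane_reflection[OF _ u, of "\<lambda>z. p z * q (z - w)"]) measurable
    have q_eq: "q (\<sigma> z - x) = q (z - y)" "q (\<sigma> z - y) = q (z - x)" for z
      by (intro order_antisym radial_decreasingD[OF q]; simp add: nd')+
    have "conv p q y + conv p q y =
       (\<integral>\<^sup>+z. p z * q (z - y) + p (\<sigma> z) * q (z - x) \<partial>lborel)"
      using reflected[of y] by (simp add: nn_integral_add q_eq conv_alt[of y])
    also have "\<dots> \<le> (\<integral>\<^sup>+z. p z * q (z - x) + p (\<sigma> z) * q (z - y) \<partial>lborel)"
    proof (rule nn_integral_mono)
      fix z
      show "p z * q (z - y) + p (\<sigma> z) * q (z - x) \<le> p z * q (z - x) + p (\<sigma> z) * q (z - y)"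
      proof (cases "z \<bullet> u \<le> \<kappa>")
        case True
        have "0 \<le> 4 * \<kappa> * (\<kappa> - z \<bullet> u)" "0 \<le> 2 * d * (\<kappa> - z \<bullet> u)"
          using \<kappa>0 d(1) True by simp_all
        then have "(norm z)\<^sup>2 \<le> (norm (\<sigma> z))\<^sup>2" "(norm (z - x))\<^sup>2 \<le> (norm (z - y))\<^sup>2"
          unfolding ns nx by linarith+
        then have "norm z \<le> norm (\<sigma> z)" "norm (z - x) \<le> norm (z - y)"
          using norm_ge_zero power2_le_imp_le by blast+
        then show ?thesis
          by (intro rearrangement_ennreal radial_decreasingD[OF p] radial_decreasingD[OF q])
      next
        case False
        have "4 * \<kappa> * (\<kappa> - z \<bullet> u) \<le> 0" "2 * d * (\<kappa> - z \<bullet> u) \<le> 0"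
          using \<kappa>0 d(1) False by (simp_all add: mult_nonneg_nonpos)
        then have "(norm (\<sigma> z))\<^sup>2 \<le> (norm z)\<^sup>2" "(norm (z - y))\<^sup>2 \<le> (norm (z - x))\<^sup>2"
          unfolding ns nx by linarith+
        then have "norm (\<sigma> z) \<le> norm z" "norm (z - y) \<le> norm (z - x)"
          using norm_ge_zero power2_le_imp_le by blast+
        then show ?thesis
          using rearrangement_ennreal[of "p z" "p (\<sigma> z)" "q (z - x)" "q (z - y)"]
          by (simp add: add.commute radial_decreasingD[OF p] radial_decreasingD[OF q])
      qed
    qed
    also have "\<dots> = conv p q x + conv p q x"
      using reflected[of x] by (simp add: nn_integral_add q_eq conv_alt[of x])
    finally have "2 * conv p q y \<le> 2 * conv p q x" by (simp add: mult_2)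
    then show ?thesis
      by (simp add: ennreal_mult_le_mult_iff)
  qed simp
qed

section \<open>The rearrangement inequality on the line\<close>

text \<open>The trilinear functional of the Riesz rearrangement inequality.\<close>

definition riesz :: "('a::euclidean_space \<Rightarrow> ennreal) \<Rightarrow> ('a \<Rightarrow> ennreal) \<Rightarrow> ('a \<Rightarrow> ennreal) \<Rightarrow> ennreal" where
  "riesz f g h = (\<integral>\<^sup>+x. \<integral>\<^sup>+y. f x * g y * h (x + y) \<partial>lborel \<partial>lborel)"

lemma riesz_eq_conv:
  assumes [measurable]: "f \<in> borel_measurable borel" "g \<in> borel_measurable borel" "h \<in> borel_measurable borel"
  shows "riesz f g h = (\<integral>\<^sup>+z. conv f g z * h z \<partial>lborel)"
  by (simp add: riesz_def nn_integral_conv_mult nn_integral_cmult mult.assoc)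

text \<open>Since \<open>a\<close> is the density of a measure without atoms, any smaller positive
  amount of its mass can be cut off on the left.\<close>

lemma cut_lower_part:
  fixes a :: "real \<Rightarrow> ennreal"
  assumes [measurable]: "a \<in> borel_measurable borel" 
    and \<alpha>: "(\<integral>\<^sup>+x. a x \<partial>lborel) = ennreal \<alpha>" and t: "0 < t" "t < \<alpha>"
  obtains p where "(\<integral>\<^sup>+x. a x * indicator {..p} x \<partial>lborel) = ennreal t"
proof -
  define A where "A = density lborel a"
  have sets_A [simp, measurable_cong]: "sets A = sets borel" and [simp]: "space A = UNIV" by (simp_all add: A_def)
  have em: "emeasure A S = (\<integral>\<^sup>+x. a x * indicator S x \<partial>lborel)" if "S \<in> sets borel" for S
    using that by (simp add: A_def emeasure_density)
  have tot: "emeasure A UNIV = ennreal \<alpha>" using \<alpha> by (simp add: em)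
  interpret A: finite_borel_measure A
    using sets_A by (auto simp: finite_borel_measure_def finite_borel_measure_axioms_def tot intro!: finite_measureI)
  have "emeasure A {x} = 0" for x
  proof -
    have "AE y in lborel. a y * indicator {x} y = 0"
      using AE_lborel_singleton[of x] by eventually_elim auto
    then show ?thesis by (simp add: em nn_integral_0_iff_AE)
  qed
  then have "isCont (cdf A) x" for x
    by (simp add: A.isCont_cdf measure_def)
  then have cont: "continuous_on S (cdf A)" for S
    by (simp add: continuous_at_imp_continuous_on)
  have "measure A (space A) = \<alpha>" using t by (simp add: measure_def tot)
  then have "eventually (\<lambda>x. t < cdf A x) at_top"
    using order_tendstoD(1)[OF A.cdf_lim_at_top, of t] t by simp
  then obtain x1 where x1: "t < cdf A x1" by (auto simp: eventually_at_top_linorder)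
  have "eventually (\<lambda>x. cdf A x < t) at_bot"
    using order_tendstoD(2)[OF A.cdf_lim_at_bot, of t] t by simp
  then obtain x0 where x0: "cdf A x0 < t" by (auto simp: eventually_at_bot_linorder)
  have "x0 \<le> x1" using A.cdf_nondecreasing[of x1 x0] x0 x1 by linarith
  then obtain p where "cdf A p = t"
    using IVT'[of "cdf A" x0 t x1] cont x0 x1 by force
  then have "emeasure A {..p} = ennreal t"
    by (simp add: cdf_def A.emeasure_eq_measure)
  then show ?thesis using that by (simp add: em)
qed

lemma cut_upper_part:
  fixes b :: "real \<Rightarrow> ennreal"
  assumes [measurable]: "b \<in> borel_measurable borel" 
    and \<beta>: "(\<integral>\<^sup>+x. b x \<partial>lborel) = ennreal \<beta>" and t: "0 < t" "t < \<beta>"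
  obtains q where "(\<integral>\<^sup>+x. b x * indicator {q..} x \<partial>lborel) = ennreal t"
proof -
  have "(\<integral>\<^sup>+x. b (- x) \<partial>lborel) = ennreal \<beta>"
    using nn_integral_lborel_reflect[of b 0] \<beta> by simp
  then obtain p where p: "(\<integral>\<^sup>+x. b (- x) * indicator {..p} x \<partial>lborel) = ennreal t"
    using cut_lower_part[of "\<lambda>x. b (- x)" \<beta> t] t by auto
  have "(\<integral>\<^sup>+x. b x * indicator {- p..} x \<partial>lborel) = ennreal t"
    using nn_integral_lborel_reflect[of "\<lambda>x. b x * indicator {- p..} x" 0] p
    by (simp add: indicator_def)
  then show ?thesis using that by blast
qed

lemma conv_le_right:
  assumes [measurable]: "g \<in> borel_measurable borel" and "\<And>x. f x \<le> 1"
  shows "conv f g z \<le> (\<integral>\<^sup>+x. g x \<partial>lborel)"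
proof -
  have "conv f g z \<le> (\<integral>\<^sup>+x. g (z - x) \<partial>lborel)"
    unfolding conv_def using mult_right_mono[OF assms(2)] by (intro nn_integral_mono) simp
  then show ?thesis by (simp add: nn_integral_lborel_reflect)
qed

lemma conv_le_left:
  assumes "\<And>x. g x \<le> 1"
  shows "conv f g z \<le> (\<integral>\<^sup>+x. f x \<partial>lborel)"
  unfolding conv_def using mult_left_mono[OF assms] by (intro nn_integral_mono) (metis mult.right_neutral zero_le)

text \<open>A continuous form of Pollard's theorem on sumsets. Remove from \<open>a\<close> its lowest part of mass \<open>t\<close> and from
  \<open>b\<close> its highest part of mass \<open>t\<close>. A pair \<open>(s, x - s)\<close> lost in this way has \<open>s\<close> below one of two
  thresholds; the larger of the two decides whether all lost pairs have \<open>s\<close> in the removed part of \<open>a\<close>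
  or all have \<open>x - s\<close> in the removed part of \<open>b\<close>. Either way the convolution drops by at most \<open>t\<close>
  at each point.\<close>

lemma conv_excess_le:
  fixes a b :: "real \<Rightarrow> ennreal"
  assumes [measurable]: "a \<in> borel_measurable borel" "b \<in> borel_measurable borel"
    and a1: "\<And>x. a x \<le> 1" and b1: "\<And>x. b x \<le> 1"
    and \<alpha>: "(\<integral>\<^sup>+x. a x \<partial>lborel) = ennreal \<alpha>" and \<beta>: "(\<integral>\<^sup>+x. b x \<partial>lborel) = ennreal \<beta>"
    and t: "0 \<le> t" "t \<le> \<alpha>" "t \<le> \<beta>"
  shows "(\<integral>\<^sup>+x. (conv a b x - ennreal t) \<partial>lborel) \<le> ennreal ((\<alpha> - t) * (\<beta> - t))"
proof -
  consider "t = 0" | "t = \<alpha>" | "t = \<beta>" | "0 < t" "t < \<alpha>" "t < \<beta>" using t by linarith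
  then show ?thesis
  proof cases
    case 1
    then show ?thesis using t by (simp add: nn_integral_conv \<alpha> \<beta> ennreal_mult)
  next
    case 2
    then have "conv a b x - ennreal t = 0" for x
      using conv_le_left[of b a x] b1 \<alpha> by (simp add: diff_eq_0_ennreal le_less_trans)
    then show ?thesis by simp
  next
    case 3
    then have "conv a b x - ennreal t = 0" for x
      using conv_le_right[of b a x] a1 \<beta> by (simp add: diff_eq_0_ennreal le_less_trans)
    then show ?thesis by simp
  next
    case 4
    obtain p where p: "(\<integral>\<^sup>+x. a x * indicator {..p} x \<partial>lborel) = ennreal t"
      using cut_lower_part[of a \<alpha> t] \<alpha> 4 by auto
    obtain q where q: "(\<integral>\<^sup>+x. b x * indicator {q..} x \<partial>lborel) = ennreal t"
      using cut_upper_part[of b \<beta> t] \<beta> 4 by auto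
    define a' where "a' x = a x * indicator {p<..} x" for x
    define b' where "b' x = b x * indicator {..<q} x" for x
    have [measurable]: "a' \<in> borel_measurable borel" "b' \<in> borel_measurable borel"
      unfolding a'_def b'_def by measurable
    have "(\<integral>\<^sup>+x. a x \<partial>lborel) = (\<integral>\<^sup>+x. a x * indicator {..p} x + a' x \<partial>lborel)"
      by (intro nn_integral_cong) (auto simp: a'_def indicator_def)
    then have "ennreal \<alpha> = ennreal t + (\<integral>\<^sup>+x. a' x \<partial>lborel)"
      by (simp add: nn_integral_add p \<alpha>)
    then have a': "(\<integral>\<^sup>+x. a' x \<partial>lborel) = ennreal (\<alpha> - t)"
      using 4 by (simp add: ennreal_minus[symmetric])
    have "(\<integral>\<^sup>+x. b x \<partial>lborel) = (\<integral>\<^sup>+x. b x * indicator {q..} x + b' x \<partial>lborel)"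
      by (intro nn_integral_cong) (auto simp: b'_def indicator_def)
    then have "ennreal \<beta> = ennreal t + (\<integral>\<^sup>+x. b' x \<partial>lborel)"
      by (simp add: nn_integral_add q \<beta>)
    then have b': "(\<integral>\<^sup>+x. b' x \<partial>lborel) = ennreal (\<beta> - t)"
      using 4 by (simp add: ennreal_minus[symmetric])
    have "conv a b x \<le> conv a' b' x + ennreal t" for x
    proof (cases "x - q \<le> p")
      case True
      have "conv a b x \<le> (\<integral>\<^sup>+s. a' s * b' (x - s) + a s * indicator {..p} s \<partial>lborel)"
        unfolding conv_def
      proof (rule nn_integral_mono)
        fix s
        show "a s * b (x - s) \<le> a' s * b' (x - s) + a s * indicator {..p} s"
          using True mult_left_mono[OF b1, of "a s" "x - s"] by (auto simp: a'_def b'_def indicator_def)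
      qed
      then show ?thesis by (simp add: nn_integral_add p conv_def)
    next
      case False
      have "conv a b x \<le> (\<integral>\<^sup>+s. a' s * b' (x - s) + b (x - s) * indicator {q..} (x - s) \<partial>lborel)"
        unfolding conv_def
      proof (rule nn_integral_mono)
        fix s
        show "a s * b (x - s) \<le> a' s * b' (x - s) + b (x - s) * indicator {q..} (x - s)"
          using False mult_right_mono[OF a1, of "b (x - s)" s] by (auto simp: a'_def b'_def indicator_def)
      qed
      moreover have "(\<integral>\<^sup>+s. b (x - s) * indicator {q..} (x - s) \<partial>lborel) = ennreal t"
        using nn_integral_lborel_reflect[of "\<lambda>s. b s * indicator {q..} s" x] q by simp
      ultimately show ?thesis by (simp add: nn_integral_add conv_def)
    qed
    then have "(\<integral>\<^sup>+x. (conv a b x - ennreal t) \<partial>lborel) \<le> (\<integral>\<^sup>+x. conv a' b' x \<partial>lborel)"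
      by (intro nn_integral_mono) (simp add: ennreal_minus_le_iff add.commute)
    also have "\<dots> = ennreal ((\<alpha> - t) * (\<beta> - t))"
      using 4 by (simp add: nn_integral_conv a' b' ennreal_mult)
    finally show ?thesis .
  qed
qed

lemma conv_intervals:
  "conv (indicator {l<..<r}) (indicator {l'<..<r'}) x
     = ennreal (min r (x - l') - max l (x - r'))" for l r l' r' x :: real
proof -
  have "conv (indicator {l<..<r}) (indicator {l'<..<r'}) x
      = (\<integral>\<^sup>+s. indicator {max l (x - r')<..<min r (x - l')} s \<partial>lborel)"
    unfolding conv_def by (intro nn_integral_cong) (auto simp: indicator_def)
  also have "\<dots> = ennreal (min r (x - l') - max l (x - r'))"
    by (cases "max l (x - r') \<le> min r (x - l')") (auto simp: ennreal_neg)
  finally show ?thesis .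
qed

lemma centered_ball_interval: "0 \<le> m \<Longrightarrow> centered_ball (ennreal m) = {- m / 2 <..< m / 2 :: real}"
  by (auto simp: centered_ball_real ennreal_less_iff)

text \<open>The level \<open>t\<close> is the one at which the superlevel set of the convolution of the two intervals has
  length \<open>\<gamma>\<close>, clipped to the admissible range of the preceding bound.\<close>

lemma riesz_intervals:
  fixes \<alpha> \<beta> \<gamma> :: real
  assumes "0 \<le> \<alpha>" "0 \<le> \<beta>" "0 \<le> \<gamma>"
    and t: "t = max 0 (min (min \<alpha> \<beta>) ((\<alpha> + \<beta> - \<gamma>) / 2))"
  shows "riesz (indicator (centered_ball \<alpha>)) (indicator (centered_ball \<beta>)) (indicator (centered_ball \<gamma> :: real set))
     = ennreal ((\<alpha> - t) * (\<beta> - t)) + ennreal t * ennreal \<gamma>"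
proof -
  have t': "0 \<le> t" "t \<le> \<alpha>" "t \<le> \<beta>" using assms by auto
  define m where "m x = min (\<alpha> / 2) (x + \<beta> / 2) - max (- \<alpha> / 2) (x - \<beta> / 2)" for x
  have [measurable]: "m \<in> borel_measurable borel" unfolding m_def by measurable
  have conv_m: "conv (indicator (centered_ball \<alpha>)) (indicator (centered_ball \<beta>)) x = ennreal (m x)" for x
    using assms by (simp add: centered_ball_interval conv_intervals m_def)
  have split: "ennreal (m x) * indicator (centered_ball \<gamma>) x
      = ennreal (m x - t) + ennreal t * indicator (centered_ball \<gamma>) x" for x
  proof (cases "x \<in> centered_ball \<gamma>")
    case True
    then have "t = 0 \<or> t \<le> m x"
      using assms by (auto simp: centered_ball_interval m_def max_def min_def split: if_splits)
    then show ?thesis using True t' by (auto simp flip: ennreal_plus)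
  next
    case False
    then have "m x \<le> t"
      using assms by (auto simp: centered_ball_interval m_def max_def min_def split: if_splits)
    then show ?thesis using False by (simp add: ennreal_neg)
  qed
  have "(\<integral>\<^sup>+x. ennreal (m x - t) \<partial>lborel) 
      = (\<integral>\<^sup>+x. conv (indicator {t - \<alpha> / 2 <..< \<alpha> / 2}) (indicator {- \<beta> / 2 <..< \<beta> / 2 - t}) x \<partial>lborel)"
    by (intro nn_integral_cong) (simp add: conv_intervals m_def, auto simp: max_def min_def algebra_simps)
  also have "\<dots> = ennreal ((\<alpha> - t) * (\<beta> - t))"
    using t' by (subst nn_integral_conv) (simp_all add: ennreal_mult)
  finally have "(\<integral>\<^sup>+x. ennreal (m x - t) \<partial>lborel) = ennreal ((\<alpha> - t) * (\<beta> - t))" .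
  then show ?thesis
    by (simp add: riesz_eq_conv conv_m split nn_integral_add nn_integral_cmult)
qed

text \<open>On the line the inequality follows from \<open>conv a b * c \<le> (conv a b - t) + t * c\<close> with the value
  of \<open>t\<close> that makes this an equality for centred intervals.\<close>

lemma riesz_real:
  fixes a b c :: "real \<Rightarrow> ennreal"
  assumes [measurable]: "a \<in> borel_measurable borel" "b \<in> borel_measurable borel" "c \<in> borel_measurable borel"
    and le1: "\<And>x. a x \<le> 1" "\<And>x. b x \<le> 1" "\<And>x. c x \<le> 1"
    and fin: "integral\<^sup>N lborel a \<noteq> \<infinity>" "integral\<^sup>N lborel b \<noteq> \<infinity>" "integral\<^sup>N lborel c \<noteq> \<infinity>"
  shows "riesz a b c \<le> riesz (indicator (centered_ball (integral\<^sup>N lborel a)))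
     (indicator (centered_ball (integral\<^sup>N lborel b))) (indicator (centered_ball (integral\<^sup>N lborel c) :: real set))"
proof -
  obtain \<alpha> where \<alpha>: "integral\<^sup>N lborel a = ennreal \<alpha>" "0 \<le> \<alpha>" using fin(1) by (cases "integral\<^sup>N lborel a") auto
  obtain \<beta> where \<beta>: "integral\<^sup>N lborel b = ennreal \<beta>" "0 \<le> \<beta>" using fin(2) by (cases "integral\<^sup>N lborel b") auto
  obtain \<gamma> where \<gamma>: "integral\<^sup>N lborel c = ennreal \<gamma>" "0 \<le> \<gamma>" using fin(3) by (cases "integral\<^sup>N lborel c") auto
  define t where "t = max 0 (min (min \<alpha> \<beta>) ((\<alpha> + \<beta> - \<gamma>) / 2))"
  have t: "0 \<le> t" "t \<le> \<alpha>" "t \<le> \<beta>" using \<alpha> \<beta> by (auto simp: t_def)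
  have "riesz a b c \<le> (\<integral>\<^sup>+z. (conv a b z - ennreal t) + ennreal t * c z \<partial>lborel)"
    unfolding riesz_eq_conv[OF assms(1-3)]
  proof (rule nn_integral_mono)
    fix z
    have "conv a b z * c z \<le> ((conv a b z - ennreal t) + ennreal t) * c z"
      by (intro mult_right_mono) (auto simp: diff_add_self_ennreal)
    also have "\<dots> \<le> (conv a b z - ennreal t) + ennreal t * c z"
      using mult_left_mono[OF le1(3)[of z], of "conv a b z - ennreal t"] by (simp add: distrib_right)
    finally show "conv a b z * c z \<le> (conv a b z - ennreal t) + ennreal t * c z" .
  qed
  also have "\<dots> \<le> ennreal ((\<alpha> - t) * (\<beta> - t)) + ennreal t * ennreal \<gamma>"
    using conv_excess_le[of a b \<alpha> \<beta> t] le1 \<alpha> \<beta> \<gamma> t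
    by (simp add: nn_integral_add nn_integral_cmult)
  also have "\<dots> = riesz (indicator (centered_ball (integral\<^sup>N lborel a)))
     (indicator (centered_ball (integral\<^sup>N lborel b))) (indicator (centered_ball (integral\<^sup>N lborel c) :: real set))"
    using riesz_intervals[OF \<alpha>(2) \<beta>(2) \<gamma>(2) t_def] by (simp add: \<alpha> \<beta> \<gamma>)
  finally show ?thesis .
qed

section \<open>Steiner symmetrization\<close>

text \<open>The mass of \<open>f\<close> on the line through \<open>x\<close> in direction \<open>u\<close>.\<close>

definition slice_length :: "'a::euclidean_space \<Rightarrow> ('a \<Rightarrow> ennreal) \<Rightarrow> 'a \<Rightarrow> ennreal" where
  "slice_length u f x = (\<integral>\<^sup>+t. f (x + t *\<^sub>R u) \<partial>lborel)"

text \<open>The Steiner symmetrization of \<open>f\<close> in the direction of the unit vector \<open>u\<close>: every line parallel to \<open>u\<close>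
  meets it in the open segment that is centred on the hyperplane orthogonal to \<open>u\<close> and has the mass of
  \<open>f\<close> on that line as its length. Applied to functions with values in the unit interval it also
  replaces them by sets. Here \<open>centered_ball\<close> is used for intervals of real numbers.\<close>

definition steiner :: "'a::euclidean_space \<Rightarrow> ('a \<Rightarrow> ennreal) \<Rightarrow> 'a set" where
  "steiner u f = {x. x \<bullet> u \<in> centered_ball (slice_length u f x)}"

lemma measurable_slice_length [measurable]:
  assumes [measurable]: "f \<in> borel_measurable borel"
  shows "slice_length u f \<in> borel_measurable borel"
  unfolding slice_length_def by measurable

lemma borel_steiner [measurable, simp]:
  assumes [measurable]: "f \<in> borel_measurable borel"
  shows "steiner u f \<in> sets borel"
proof -
  have "{x \<in> space borel. ennreal (2 * \<bar>x \<bullet> u\<bar>) < slice_length u f x} \<in> sets borel"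
    by measurable
  then show ?thesis by (simp add: steiner_def centered_ball_real)
qed

lemma slice_length_line:
  assumes [measurable]: "f \<in> borel_measurable borel"
  shows "slice_length u f (x + s *\<^sub>R u) = slice_length u f x"
  using nn_integral_lborel_translate[of "\<lambda>t. f (x + t *\<^sub>R u)" s]
  by (simp add: slice_length_def algebra_simps)

lemma indicator_steiner_line:
  assumes [measurable]: "f \<in> borel_measurable borel" and u: "norm u = 1"
  shows "indicator (steiner u f) (x + s *\<^sub>R u)
    = (indicator (centered_ball (slice_length u f x)) (s + x \<bullet> u) :: ennreal)"
  using u by (simp add: steiner_def indicator_def slice_length_line norm_eq_1 inner_add_left add.commute)

lemma slice_length_steiner:
  assumes [measurable]: "f \<in> borel_measurable borel" and u: "norm u = 1"
  shows "slice_length u (indicator (steiner u f)) x = slice_length u f x"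
  using nn_integral_lborel_translate[of "indicator (centered_ball (slice_length u f x))" "x \<bullet> u"]
  by (simp add: slice_length_def[of u "indicator _"] indicator_steiner_line u)

lemma nn_integral_slice_length:
  assumes "f \<in> borel_measurable borel" "norm u = 1"
  shows "(\<integral>\<^sup>+x. f x \<partial>lborel) = (\<integral>\<^sup>+x. indicator {0..1} (x \<bullet> u) * slice_length u f x \<partial>lborel)"
  unfolding slice_length_def by (rule nn_integral_slices[OF assms])

lemma emeasure_steiner:
  assumes [measurable]: "f \<in> borel_measurable borel" and u: "norm u = 1"
  shows "emeasure lborel (steiner u f) = integral\<^sup>N lborel f"
proof -
  have "emeasure lborel (steiner u f) = (\<integral>\<^sup>+x. indicator (steiner u f) x \<partial>lborel)" by simp
  also have "\<dots> = integral\<^sup>N lborel f"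
    by (subst (1 2) nn_integral_slice_length[OF _ u]) (simp_all add: slice_length_steiner u)
  finally show ?thesis .
qed

lemma riesz_slices:
  fixes f g h :: "'a::euclidean_space \<Rightarrow> ennreal"
  assumes [measurable]: "f \<in> borel_measurable borel" "g \<in> borel_measurable borel" "h \<in> borel_measurable borel"
    and u: "norm u = 1"
  shows "riesz f g h = (\<integral>\<^sup>+x. indicator {0..1} (x \<bullet> u) * (\<integral>\<^sup>+y. indicator {0..1} (y \<bullet> u) *
    riesz (\<lambda>s. f (x + s *\<^sub>R u)) (\<lambda>s. g (y + s *\<^sub>R u)) (\<lambda>s. h (x + y + s *\<^sub>R u)) \<partial>lborel) \<partial>lborel)"
proof -
  have "riesz f g h = (\<integral>\<^sup>+x. indicator {0..1} (x \<bullet> u) * (\<integral>\<^sup>+s. (\<integral>\<^sup>+y. f (x + s *\<^sub>R u) * g y * h (x + s *\<^sub>R u + y) \<partial>lborel) \<partial>lborel) \<partial>lborel)"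
    unfolding riesz_def by (rule nn_integral_slices[OF _ u]) measurable
  also have "\<dots> = (\<integral>\<^sup>+x. indicator {0..1} (x \<bullet> u) * (\<integral>\<^sup>+y. indicator {0..1} (y \<bullet> u) *
    riesz (\<lambda>s. f (x + s *\<^sub>R u)) (\<lambda>s. g (y + s *\<^sub>R u)) (\<lambda>s. h (x + y + s *\<^sub>R u)) \<partial>lborel) \<partial>lborel)"
  proof (rule nn_integral_cong)
    fix x
    have "(\<integral>\<^sup>+s. (\<integral>\<^sup>+y. f (x + s *\<^sub>R u) * g y * h (x + s *\<^sub>R u + y) \<partial>lborel) \<partial>lborel)
       = (\<integral>\<^sup>+y. (\<integral>\<^sup>+s. f (x + s *\<^sub>R u) * g y * h (x + s *\<^sub>R u + y) \<partial>lborel) \<partial>lborel)"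
      by (rule lborel_Fubini) measurable
    also have "\<dots> = (\<integral>\<^sup>+y. indicator {0..1} (y \<bullet> u) * (\<integral>\<^sup>+t. (\<integral>\<^sup>+s. f (x + s *\<^sub>R u) * g (y + t *\<^sub>R u) * h (x + s *\<^sub>R u + (y + t *\<^sub>R u)) \<partial>lborel) \<partial>lborel) \<partial>lborel)"
      by (rule nn_integral_slices[OF _ u]) measurable
    also have "\<dots> = (\<integral>\<^sup>+y. indicator {0..1} (y \<bullet> u) * riesz (\<lambda>s. f (x + s *\<^sub>R u)) (\<lambda>s. g (y + s *\<^sub>R u)) (\<lambda>s. h (x + y + s *\<^sub>R u)) \<partial>lborel)"
    proof (rule nn_integral_cong)
      fix y
      have "(\<integral>\<^sup>+t. (\<integral>\<^sup>+s. f (x + s *\<^sub>R u) * g (y + t *\<^sub>R u) * h (x + s *\<^sub>R u + (y + t *\<^sub>R u)) \<partial>lborel) \<partial>lborel)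
         = (\<integral>\<^sup>+s. (\<integral>\<^sup>+t. f (x + s *\<^sub>R u) * g (y + t *\<^sub>R u) * h (x + s *\<^sub>R u + (y + t *\<^sub>R u)) \<partial>lborel) \<partial>lborel)"
        by (rule lborel_Fubini) measurable
      also have "\<dots> = riesz (\<lambda>s. f (x + s *\<^sub>R u)) (\<lambda>s. g (y + s *\<^sub>R u)) (\<lambda>s. h (x + y + s *\<^sub>R u))"
        by (simp add: riesz_def algebra_simps)
      finally show "indicator {0..1} (y \<bullet> u) * (\<integral>\<^sup>+t. (\<integral>\<^sup>+s. f (x + s *\<^sub>R u) * g (y + t *\<^sub>R u) * h (x + s *\<^sub>R u + (y + t *\<^sub>R u)) \<partial>lborel) \<partial>lborel)
         = indicator {0..1} (y \<bullet> u) * riesz (\<lambda>s. f (x + s *\<^sub>R u)) (\<lambda>s. g (y + s *\<^sub>R u)) (\<lambda>s. h (x + y + s *\<^sub>R u))"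
        by simp
    qed
    finally show "indicator {0..1} (x \<bullet> u) * (\<integral>\<^sup>+s. (\<integral>\<^sup>+y. f (x + s *\<^sub>R u) * g y * h (x + s *\<^sub>R u + y) \<partial>lborel) \<partial>lborel)
      = indicator {0..1} (x \<bullet> u) * (\<integral>\<^sup>+y. indicator {0..1} (y \<bullet> u) *
        riesz (\<lambda>s. f (x + s *\<^sub>R u)) (\<lambda>s. g (y + s *\<^sub>R u)) (\<lambda>s. h (x + y + s *\<^sub>R u)) \<partial>lborel)"
      by simp
  qed
  finally show ?thesis .
qed

lemma riesz_translate:
  fixes f g h :: "'a::euclidean_space \<Rightarrow> ennreal"
  assumes [measurable]: "f \<in> borel_measurable borel" "g \<in> borel_measurable borel" "h \<in> borel_measurable borel"
  shows "riesz (\<lambda>x. f (x + a)) (\<lambda>y. g (y + b)) (\<lambda>z. h (z + (a + b))) = riesz f g h"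
proof -
  have "(\<integral>\<^sup>+y. f (x + a) * g (y + b) * h (x + y + (a + b)) \<partial>lborel)
     = (\<integral>\<^sup>+y. f (x + a) * g y * h (x + a + y) \<partial>lborel)" for x
    using nn_integral_lborel_translate[of "\<lambda>y. f (x + a) * g y * h (x + a + y)" b]
    by (simp add: add_ac)
  then show ?thesis
    using nn_integral_lborel_translate[of "\<lambda>x. \<integral>\<^sup>+y. f x * g y * h (x + y) \<partial>lborel" a]
    by (simp add: riesz_def)
qed

lemma slice_length_bounded_support:
  fixes f :: "'a::euclidean_space \<Rightarrow> ennreal"
  assumes le1: "\<And>x. f x \<le> 1" and supp: "\<And>x. R \<le> norm x \<Longrightarrow> f x = 0" and u: "norm u = 1"
  shows "slice_length u f x \<le> ennreal (2 * sqrt (R\<^sup>2 - ((norm x)\<^sup>2 - (x \<bullet> u)\<^sup>2)))"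
    and "slice_length u f x \<noteq> 0 \<Longrightarrow> (norm x)\<^sup>2 - (x \<bullet> u)\<^sup>2 \<le> R\<^sup>2"
proof -
  define D where "D = R\<^sup>2 - ((norm x)\<^sup>2 - (x \<bullet> u)\<^sup>2)"
  have *: "f (x + t *\<^sub>R u) = 0" if "D \<le> (t + x \<bullet> u)\<^sup>2" for t
  proof (rule supp)
    have "R\<^sup>2 \<le> (norm (x + t *\<^sub>R u))\<^sup>2"
      using that unfolding norm_add_unit_vector[OF u] D_def by (simp add: power2_eq_square algebra_simps)
    then show "R \<le> norm (x + t *\<^sub>R u)"
      using norm_ge_zero power2_le_imp_le by blast
  qed
  have "slice_length u f x \<le> (\<integral>\<^sup>+t. indicator {- sqrt D - x \<bullet> u .. sqrt D - x \<bullet> u} t \<partial>lborel)"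
    unfolding slice_length_def
  proof (rule nn_integral_mono)
    fix t
    show "f (x + t *\<^sub>R u) \<le> indicator {- sqrt D - x \<bullet> u .. sqrt D - x \<bullet> u} t"
    proof (cases "D \<le> (t + x \<bullet> u)\<^sup>2")
      case False
      then have "\<bar>t + x \<bullet> u\<bar> \<le> sqrt D" by (intro real_le_rsqrt) simp
      then show ?thesis using le1 by (auto simp: indicator_def abs_le_iff)
    qed (simp add: *)
  qed
  also have "\<dots> \<le> ennreal (2 * sqrt D)"
    by (cases "0 \<le> sqrt D") (auto simp: ennreal_neg)
  finally show "slice_length u f x \<le> ennreal (2 * sqrt (R\<^sup>2 - ((norm x)\<^sup>2 - (x \<bullet> u)\<^sup>2)))"
    by (simp add: D_def)
  show "(norm x)\<^sup>2 - (x \<bullet> u)\<^sup>2 \<le> R\<^sup>2" if "slice_length u f x \<noteq> 0"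
  proof (rule ccontr)
    assume "\<not> ?thesis"
    then have "D \<le> (t + x \<bullet> u)\<^sup>2" for t using zero_le_power2[of "t + x \<bullet> u"] unfolding D_def by linarith
    then show False using that * by (simp add: slice_length_def)
  qed
qed

lemma steiner_subset_ball:
  fixes f :: "'a::euclidean_space \<Rightarrow> ennreal"
  assumes le1: "\<And>x. f x \<le> 1" and supp: "\<And>x. R \<le> norm x \<Longrightarrow> f x = 0" and u: "norm u = 1" and R: "0 \<le> R"
  shows "steiner u f \<subseteq> ball 0 R"
proof
  fix x assume "x \<in> steiner u f"
  then have *: "ennreal (2 * \<bar>x \<bullet> u\<bar>) < slice_length u f x"
    by (simp add: steiner_def centered_ball_real)
  also have "\<dots> \<le> ennreal (2 * sqrt (R\<^sup>2 - ((norm x)\<^sup>2 - (x \<bullet> u)\<^sup>2)))"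
    by (rule slice_length_bounded_support) (use le1 supp u in auto)
  finally have "\<bar>x \<bullet> u\<bar> < sqrt (R\<^sup>2 - ((norm x)\<^sup>2 - (x \<bullet> u)\<^sup>2))"
    by (simp add: ennreal_less_iff)
  moreover have "0 \<le> R\<^sup>2 - ((norm x)\<^sup>2 - (x \<bullet> u)\<^sup>2)"
  proof -
    have "(norm x)\<^sup>2 - (x \<bullet> u)\<^sup>2 \<le> R\<^sup>2"
      by (rule slice_length_bounded_support(2)[of f]) (use le1 supp u * in auto)
    then show ?thesis by simp
  qed
  ultimately have "\<bar>x \<bullet> u\<bar>\<^sup>2 < R\<^sup>2 - ((norm x)\<^sup>2 - (x \<bullet> u)\<^sup>2)"
    by (metis abs_ge_zero power_strict_mono real_sqrt_pow2 zero_less_numeral)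
  then have "(norm x)\<^sup>2 < R\<^sup>2" by simp
  then show "x \<in> ball 0 R" using R by (simp add: power2_less_imp_less)
qed

text \<open>The support condition makes all slices finite.\<close>

lemma riesz_steiner:
  fixes f g h :: "'a::euclidean_space \<Rightarrow> ennreal"
  assumes [measurable]: "f \<in> borel_measurable borel" "g \<in> borel_measurable borel" "h \<in> borel_measurable borel"
    and le1: "\<And>x. f x \<le> 1" "\<And>x. g x \<le> 1" "\<And>x. h x \<le> 1"
    and supp: "\<And>x. R \<le> norm x \<Longrightarrow> f x = 0" "\<And>x. R \<le> norm x \<Longrightarrow> g x = 0" "\<And>x. R \<le> norm x \<Longrightarrow> h x = 0"
    and u: "norm u = 1"
  shows "riesz f g h \<le> riesz (indicator (steiner u f)) (indicator (steiner u g)) (indicator (steiner u h))"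
  unfolding riesz_slices[OF assms(1-3) u]
proof (subst riesz_slices[OF _ _ _ u], measurable, intro nn_integral_mono mult_left_mono zero_le)
  fix x y
  let ?I = "\<lambda>f x. indicator (centered_ball (slice_length u f x)) :: real \<Rightarrow> ennreal"
  have fin: "slice_length u f x \<noteq> \<infinity>" "slice_length u g y \<noteq> \<infinity>" "slice_length u h (x + y) \<noteq> \<infinity>"
    using slice_length_bounded_support(1)[of f R u x, OF le1(1)] slice_length_bounded_support(1)[of g R u y, OF le1(2)]
      slice_length_bounded_support(1)[of h R u "x + y", OF le1(3)] supp u
    by (auto simp: top_unique)
  have "riesz (\<lambda>s. f (x + s *\<^sub>R u)) (\<lambda>s. g (y + s *\<^sub>R u)) (\<lambda>s. h (x + y + s *\<^sub>R u))
    \<le> riesz (?I f x) (?I g y) (?I h (x + y))"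
    unfolding slice_length_def
    by (rule riesz_real) (use le1 fin in \<open>simp_all add: slice_length_def\<close>)
  also have "\<dots> = riesz (\<lambda>s. ?I f x (s + x \<bullet> u)) (\<lambda>s. ?I g y (s + y \<bullet> u))
      (\<lambda>s. ?I h (x + y) (s + (x \<bullet> u + y \<bullet> u)))"
    by (rule riesz_translate[symmetric]) measurable
  also have "\<dots> = riesz (\<lambda>s. indicator (steiner u f) (x + s *\<^sub>R u))
     (\<lambda>s. indicator (steiner u g) (y + s *\<^sub>R u)) (\<lambda>s. indicator (steiner u h) (x + y + s *\<^sub>R u))"
    by (simp add: indicator_steiner_line u inner_add_left)
  finally show "riesz (\<lambda>s. f (x + s *\<^sub>R u)) (\<lambda>s. g (y + s *\<^sub>R u)) (\<lambda>s. h (x + y + s *\<^sub>R u))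
    \<le> riesz (\<lambda>s. indicator (steiner u f) (x + s *\<^sub>R u))
     (\<lambda>s. indicator (steiner u g) (y + s *\<^sub>R u)) (\<lambda>s. indicator (steiner u h) (x + y + s *\<^sub>R u))" .
qed

section \<open>The rearrangement inequality in Euclidean space\<close>

lemma steiner_ball:
  fixes u :: "'a::euclidean_space"
  assumes u: "norm u = 1"
  shows "steiner u (indicator (ball 0 \<rho>)) = ball (0::'a) \<rho>"
proof (cases "0 \<le> \<rho>")
  case False
  then have "ball (0::'a) \<rho> = {}" by simp
  then show ?thesis unfolding \<open>ball 0 \<rho> = {}\<close> by (simp add: steiner_def slice_length_def)
next
  case \<rho>: True
  have "x \<bullet> u \<in> centered_ball (slice_length u (indicator (ball 0 \<rho>)) x) \<longleftrightarrow> x \<in> ball 0 \<rho>" for x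
  proof -
    define D where "D = \<rho>\<^sup>2 - ((norm x)\<^sup>2 - (x \<bullet> u)\<^sup>2)"
    have in_ball: "norm (x + t *\<^sub>R u) < \<rho> \<longleftrightarrow> (t + x \<bullet> u)\<^sup>2 < D" for t
    proof -
      have "norm (x + t *\<^sub>R u) < \<rho> \<longleftrightarrow> (norm (x + t *\<^sub>R u))\<^sup>2 < \<rho>\<^sup>2"
        using \<rho> by (simp add: power_mono_iff flip: not_le)
      then show ?thesis
        unfolding norm_add_unit_vector[OF u] D_def by (simp add: power2_eq_square algebra_simps)
    qed
    show ?thesis
    proof (cases "0 < D")
      case True
      have sq: "s\<^sup>2 < D \<longleftrightarrow> \<bar>s\<bar> < sqrt D" for s
        by (metis real_sqrt_abs real_sqrt_less_iff)
      have "slice_length u (indicator (ball 0 \<rho>)) x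
          = (\<integral>\<^sup>+t. indicator {- sqrt D - x \<bullet> u <..< sqrt D - x \<bullet> u} t \<partial>lborel)"
        unfolding slice_length_def
        by (intro nn_integral_cong) (auto simp: indicator_def in_ball sq abs_less_iff)
      also have "\<dots> = ennreal (2 * sqrt D)" using True by simp
      finally show ?thesis
        using True in_ball[of 0] by (simp add: centered_ball_real ennreal_less_iff sq)
    next
      case False
      then have "\<not> s\<^sup>2 < D" for s using zero_le_power2[of s] by linarith
      then show ?thesis using in_ball[of 0] 
        by (simp add: slice_length_def in_ball indicator_def)
    qed
  qed
  then show ?thesis unfolding steiner_def by blast
qed

text \<open>On each line the symmetrized slice of \<open>A\<close> meets the slice of \<open>B\<close> in the smaller of the two lengths.
  Points of \<open>B - A\<close> that are translates, along the line, of points of \<open>A - B\<close> are therefore gained.\<close>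

lemma steiner_overlap_gain:
  fixes A B :: "'a::euclidean_space set"
  assumes [measurable]: "A \<in> sets borel" "B \<in> sets borel"
    and u: "norm u = 1" and B: "steiner u (indicator B) = B"
  shows "emeasure lborel (A \<inter> B) + emeasure lborel {x. x \<in> B - A \<and> x - l *\<^sub>R u \<in> A - B}
     \<le> emeasure lborel (steiner u (indicator A) \<inter> B)"
proof -
  define E where "E = {x. x \<in> B - A \<and> x - l *\<^sub>R u \<in> A - B}"
  have [measurable]: "E \<in> sets borel"
  proof -
    have "{x \<in> space borel. x \<in> B - A \<and> x - l *\<^sub>R u \<in> A - B} \<in> sets borel" by measurable
    then show ?thesis by (simp add: E_def)
  qed
  have slices: "slice_length u (\<lambda>x. indicator (A \<inter> B) x + indicator E x) x
      \<le> slice_length u (indicator (steiner u (indicator A) \<inter> B)) x" for x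
  proof -
    let ?a = "slice_length u (indicator A) x" and ?b = "slice_length u (indicator B) x"
    have "slice_length u (indicator (steiner u (indicator A) \<inter> B)) x
       = (\<integral>\<^sup>+t. indicator (centered_ball (min ?a ?b)) (t + x \<bullet> u) \<partial>lborel)"
      unfolding slice_length_def[of u "indicator (_ \<inter> _)"]
    proof (rule nn_integral_cong)
      fix t
      have "centered_ball ?a \<inter> centered_ball ?b = (centered_ball (min ?a ?b) :: real set)"
        by (auto simp: centered_ball_def)
      then show "indicator (steiner u (indicator A) \<inter> B) (x + t *\<^sub>R u)
        = (indicator (centered_ball (min ?a ?b)) (t + x \<bullet> u) :: ennreal)"
        using indicator_steiner_line[of "indicator A" u x t] indicator_steiner_line[of "indicator B" u x t] u
        unfolding B by (simp add: indicator_inter_arith flip: \<open>_ = centered_ball (min ?a ?b)\<close>)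
    qed
    also have "\<dots> = min ?a ?b"
      using nn_integral_lborel_translate[of "indicator (centered_ball (min ?a ?b))" "x \<bullet> u"] by simp
    finally have rhs: "slice_length u (indicator (steiner u (indicator A) \<inter> B)) x = min ?a ?b" .
    have "slice_length u (\<lambda>x. indicator (A \<inter> B) x + indicator E x) x \<le> ?b"
      unfolding slice_length_def by (intro nn_integral_mono) (auto simp: indicator_def E_def)
    moreover have "slice_length u (\<lambda>x. indicator (A \<inter> B) x + indicator E x) x \<le> ?a"
    proof -
      have "slice_length u (\<lambda>x. indicator (A \<inter> B) x + indicator E x) x 
         = slice_length u (indicator (A \<inter> B)) x + slice_length u (indicator E) x"
        unfolding slice_length_def by (rule nn_integral_add) measurable
      also have "slice_length u (indicator E) x \<le> slice_length u (indicator (A - B)) (x + (- l) *\<^sub>R u)"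
        unfolding slice_length_def
        by (intro nn_integral_mono) (auto simp: indicator_def E_def algebra_simps)
      also have "\<dots> = slice_length u (indicator (A - B)) x"
        by (rule slice_length_line) measurable
      also have "slice_length u (indicator (A \<inter> B)) x + slice_length u (indicator (A - B)) x
         = slice_length u (\<lambda>x. indicator (A \<inter> B) x + indicator (A - B) x) x"
        unfolding slice_length_def by (rule nn_integral_add[symmetric]) measurable
      also have "(\<lambda>x. indicator (A \<inter> B) x + indicator (A - B) x :: ennreal) = indicator A"
        by (auto simp: indicator_def)
      finally show ?thesis by (simp add: add_left_mono)
    qed
    ultimately show ?thesis unfolding rhs by simp
  qed
  have "emeasure lborel (A \<inter> B) + emeasure lborel E = (\<integral>\<^sup>+x. indicator (A \<inter> B) x + indicator E x \<partial>lborel)"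
    by (subst nn_integral_add) simp_all
  also have "\<dots> \<le> (\<integral>\<^sup>+x. indicator (steiner u (indicator A) \<inter> B) x \<partial>lborel)"
    by (subst (1 2) nn_integral_slice_length[OF _ u])
       (auto intro!: nn_integral_mono mult_left_mono slices)
  finally show ?thesis by (simp add: E_def)
qed

text \<open>Integrated over \<open>v\<close>, the measure of the intersection of \<open>P\<close> with the translate of \<open>Q\<close> by \<open>v\<close> gives the
  product of the two measures, and only vectors \<open>v\<close> of norm below \<open>2 * R\<close> contribute.\<close>

lemma product_le_of_overlap_le:
  fixes P Q :: "'a::euclidean_space set"
  assumes [measurable]: "P \<in> sets borel" "Q \<in> sets borel"
    and sub: "P \<subseteq> ball 0 R" "Q \<subseteq> ball 0 R"
    and le: "\<And>v. emeasure lborel {x. x \<in> P \<and> x - v \<in> Q} \<le> \<eta>"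
  shows "emeasure lborel P * emeasure lborel Q \<le> \<eta> * emeasure lborel (ball (0::'a) (2 * R))"
proof -
  have "emeasure lborel P * emeasure lborel Q = (\<integral>\<^sup>+x. indicator P x * (\<integral>\<^sup>+v. indicator Q (x - v) \<partial>lborel) \<partial>lborel)"
    by (simp add: nn_integral_lborel_reflect nn_integral_multc)
  also have "\<dots> = (\<integral>\<^sup>+x. \<integral>\<^sup>+v. indicator P x * indicator Q (x - v) \<partial>lborel \<partial>lborel)"
    by (intro nn_integral_cong nn_integral_cmult[symmetric]) measurable
  also have "\<dots> = (\<integral>\<^sup>+v. \<integral>\<^sup>+x. indicator P x * indicator Q (x - v) \<partial>lborel \<partial>lborel)"
    by (rule lborel_Fubini) measurable
  also have "\<dots> \<le> (\<integral>\<^sup>+v. \<eta> * indicator (ball (0::'a) (2 * R)) v \<partial>lborel)"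
  proof (rule nn_integral_mono)
    fix v
    have [measurable]: "{x. x \<in> P \<and> x - v \<in> Q} \<in> sets borel"
    proof -
      have "{x \<in> space borel. x \<in> P \<and> x - v \<in> Q} \<in> sets borel" by measurable
      then show ?thesis by simp
    qed
    have "(\<integral>\<^sup>+x. indicator P x * indicator Q (x - v) \<partial>lborel) = (\<integral>\<^sup>+x. indicator {x. x \<in> P \<and> x - v \<in> Q} x \<partial>lborel)"
      by (intro nn_integral_cong) (auto simp: indicator_def)
    also have "\<dots> = emeasure lborel {x. x \<in> P \<and> x - v \<in> Q}" by simp
    also have "\<dots> \<le> \<eta> * indicator (ball (0::'a) (2 * R)) v"
    proof (cases "v \<in> ball 0 (2 * R)")
      case False
      have "\<not> (x \<in> P \<and> x - v \<in> Q)" for x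
      proof
        assume "x \<in> P \<and> x - v \<in> Q"
        then have "norm x < R" "norm (x - v) < R" using sub by auto
        moreover have "norm v \<le> norm x + norm (x - v)"
          using norm_triangle_ineq4[of x "x - v"] by simp
        ultimately show False using False by simp
      qed
      then have "{x. x \<in> P \<and> x - v \<in> Q} = {}" by blast
      then show ?thesis by (metis emeasure_empty zero_le)
    qed (simp add: le)
    finally show "(\<integral>\<^sup>+x. indicator P x * indicator Q (x - v) \<partial>lborel) \<le> \<eta> * indicator (ball (0::'a) (2 * R)) v" .
  qed
  also have "\<dots> = \<eta> * emeasure lborel (ball (0::'a) (2 * R))"
    by (simp add: nn_integral_cmult_indicator)
  finally show ?thesis .
qed

text \<open>Among all triples with the given measures inside the ball and with a Riesz functional at least that of
  \<open>A\<close>, take one whose total overlap with the centred balls is nearly maximal. One more symmetrization, in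
  whatever direction, gains almost nothing, so by the two preceding lemmas each set is close to its ball.\<close>

lemma approximate_by_symmetrization:
  fixes A :: "nat \<Rightarrow> 'a::euclidean_space set"
  assumes A: "\<And>i. i < 3 \<Longrightarrow> A i \<in> sets borel" "\<And>i. i < 3 \<Longrightarrow> A i \<subseteq> ball 0 R"
    and R: "0 < R" and \<epsilon>: "0 < \<epsilon>"
  shows "\<exists>G :: nat \<Rightarrow> 'a set.
    (\<forall>i<3. G i \<in> sets borel \<and> emeasure lborel (G i) = emeasure lborel (A i) \<and>
       measure lborel (G i - centered_ball (emeasure lborel (A i))) \<le> \<epsilon>) \<and>
    riesz (indicator (A 0)) (indicator (A 1)) (indicator (A 2))
      \<le> riesz (indicator (G 0)) (indicator (G 1)) (indicator (G 2))"
proof -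
  define B where "B i = (centered_ball (emeasure lborel (A i)) :: 'a set)" for i
  have [measurable, simp]: "B i \<in> sets borel" for i by (simp add: B_def)
  have finR: "emeasure lborel S < \<infinity>" if "S \<subseteq> ball (0::'a) R" for S
    using emeasure_mono[of S "ball 0 R" lborel] that le_less_trans[OF _ emeasure_lborel_ball_finite[of "0::'a" R]] by simp
  have emB: "emeasure lborel (B i) = emeasure lborel (A i)" for i by (simp add: B_def)
  have B_ball: "\<exists>\<rho>. B i = ball 0 \<rho>" "B i \<subseteq> ball 0 R" if "i < 3" for i
  proof -
    have "emeasure lborel (A i) \<noteq> \<infinity>" using finR[OF A(2)[OF that]] by simp
    then show "\<exists>\<rho>. B i = ball 0 \<rho>" by (metis B_def centered_ball_obtain)
    have "emeasure lborel (A i) \<le> emeasure lborel (ball (0::'a) R)"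
      using A[OF that] by (intro emeasure_mono) auto
    then have "B i \<subseteq> centered_ball (emeasure lborel (ball (0::'a) R))"
      unfolding B_def by (rule centered_ball_mono)
    also have "\<dots> = ball 0 R" using R by (intro centered_ball_eq_ball) auto
    finally show "B i \<subseteq> ball 0 R" .
  qed
  have fm: "emeasure lborel S = ennreal (measure lborel S)" if "S \<subseteq> ball (0::'a) R" for S
    using finR[OF that] by (simp add: emeasure_eq_ennreal_measure)
  define T where "T = {G :: nat \<Rightarrow> 'a set. (\<forall>i<3. G i \<in> sets borel \<and> G i \<subseteq> ball 0 R \<and> emeasure lborel (G i) = emeasure lborel (A i)) \<and>
     riesz (indicator (A 0)) (indicator (A 1)) (indicator (A 2))
      \<le> riesz (indicator (G 0)) (indicator (G 1)) (indicator (G 2))}"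
  define \<Phi> where "\<Phi> G = (\<Sum>i<3. measure lborel (G i \<inter> B i))" for G :: "nat \<Rightarrow> 'a set"
  have mB: "measure lborel (S \<inter> B i) \<le> measure lborel (B i)" if "i < 3" "S \<in> sets borel" for i S
    using that finR[OF B_ball(2)[OF that(1)]] by (intro measure_mono_fmeasurable) (auto simp: fmeasurable_def)
  have bdd: "bdd_above (\<Phi> ` T)"
  proof (rule bdd_aboveI2)
    show "\<Phi> G \<le> (\<Sum>i<3. measure lborel (B i))" if "G \<in> T" for G
      unfolding \<Phi>_def using that by (intro sum_mono mB) (auto simp: T_def)
  qed
  have AT: "A \<in> T" using A by (auto simp: T_def)
  define V where "V = measure lborel (ball (0::'a) (2 * R))"
  have V: "0 < V" using R by (simp add: V_def)
  have emV: "emeasure lborel (ball (0::'a) (2 * R)) = ennreal V"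
    using emeasure_lborel_ball_finite[of "0::'a" "2 * R"] by (simp add: V_def emeasure_eq_ennreal_measure)
  \<comment> \<open>chosen so that the squared deviation from the ball, which is at most \<open>\<eta> * V\<close>, is at most \<open>\<epsilon>\<^sup>2\<close>\<close>
  define \<eta> where "\<eta> = \<epsilon>\<^sup>2 / V"
  have \<eta>: "0 < \<eta>" using \<epsilon> V by (simp add: \<eta>_def)
  have "(SUP G\<in>T. \<Phi> G) - \<eta> < (SUP G\<in>T. \<Phi> G)" using \<eta> by simp
  then obtain G where G: "G \<in> T" "(SUP G\<in>T. \<Phi> G) - \<eta> < \<Phi> G"
    using less_cSUP_iff[OF _ bdd] AT by blast
  have Gi [measurable]: "G i \<in> sets borel" and GR: "G i \<subseteq> ball 0 R"
    and GA: "emeasure lborel (G i) = emeasure lborel (A i)" if "i < 3" for i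
    using G(1) that by (auto simp: T_def)
  have Gsupp: "indicator (G i) x = (0::ennreal)" if "i < 3" "R \<le> norm x" for i x
    using GR[OF that(1)] that(2) by (auto simp: indicator_def)
  have ind1: "indicator S x \<le> (1::ennreal)" for S and x :: 'a by (simp add: indicator_def)
  \<comment> \<open>for \<open>v \<noteq> 0\<close> the gain of a symmetrization in direction \<open>v\<close> is bounded by the slack \<open>\<eta>\<close>\<close>
  have gain: "emeasure lborel {x. x \<in> B i - G i \<and> x - v \<in> G i - B i} \<le> ennreal \<eta>" if i: "i < 3" for i v
  proof (cases "v = 0")
    case True
    then have "{x. x \<in> B i - G i \<and> x - v \<in> G i - B i} = {}" by auto
    then show ?thesis by (metis emeasure_empty zero_le)
  next
    case False
    define u where "u = v /\<^sub>R norm v"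
    have u: "norm u = 1" and v: "v = norm v *\<^sub>R u" using False by (simp_all add: u_def)
    define H where "H j = steiner u (indicator (G j))" for j
    let ?E = "\<lambda>j. {x. x \<in> B j - G j \<and> x - v \<in> G j - B j}"
    have HT: "H \<in> T"
    proof -
      have "riesz (indicator (G 0)) (indicator (G 1)) (indicator (G 2))
        \<le> riesz (indicator (H 0)) (indicator (H 1)) (indicator (H 2))"
        unfolding H_def by (rule riesz_steiner[where R=R]) (simp_all add: ind1 Gsupp u Gi)
      moreover have "H j \<subseteq> ball 0 R" if "j < 3" for j
        unfolding H_def by (rule steiner_subset_ball) (use that R in \<open>simp_all add: ind1 Gsupp u\<close>)
      ultimately show ?thesis
        using G(1) by (auto simp: T_def H_def emeasure_steiner u Gi)
    qed
    have step: "measure lborel (G j \<inter> B j) + measure lborel (?E j) \<le> measure lborel (H j \<inter> B j)" if "j < 3" for j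
    proof -
      have "steiner u (indicator (B j)) = B j"
        using B_ball(1)[OF that] steiner_ball[OF u] by metis
      then have "emeasure lborel (G j \<inter> B j) + emeasure lborel (?E j) \<le> emeasure lborel (H j \<inter> B j)"
        using steiner_overlap_gain[of "G j" "B j" u "norm v"] Gi[OF that] u by (simp add: H_def flip: v)
      moreover have "G j \<inter> B j \<subseteq> ball 0 R" "?E j \<subseteq> ball 0 R" "H j \<inter> B j \<subseteq> ball 0 R"
        using B_ball(2)[OF that] by blast+
      ultimately have "ennreal (measure lborel (G j \<inter> B j) + measure lborel (?E j))
          \<le> ennreal (measure lborel (H j \<inter> B j))"
        by (simp only: fm ennreal_plus measure_nonneg)
      then show ?thesis by (subst (asm) ennreal_le_iff) (rule measure_nonneg)
    qed
    have "\<Phi> G + measure lborel (?E i) \<le> \<Phi> G + (\<Sum>j<3. measure lborel (?E j))"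
      using i by (intro add_left_mono member_le_sum) auto
    also have "\<dots> \<le> \<Phi> H"
      unfolding \<Phi>_def by (simp only: sum.distrib[symmetric]) (intro sum_mono step, simp)
    also have "\<dots> \<le> (SUP G\<in>T. \<Phi> G)" using HT bdd by (rule cSUP_upper)
    finally have "measure lborel (?E i) \<le> \<eta>" using G(2) by linarith
    moreover have "?E i \<subseteq> ball 0 R" using B_ball(2)[OF i] by auto
    ultimately show ?thesis by (simp add: fm ennreal_leI)
  qed
  have "measure lborel (G i - B i) \<le> \<epsilon>" if i: "i < 3" for i
  proof -
    have "emeasure lborel (B i - G i) * emeasure lborel (G i - B i)
        \<le> ennreal \<eta> * emeasure lborel (ball (0::'a) (2 * R))"
      using Gi[OF i] GR[OF i] B_ball(2)[OF i] gain[OF i]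
      by (intro product_le_of_overlap_le) auto
    moreover have "B i - G i \<subseteq> ball 0 R" "G i - B i \<subseteq> ball 0 R"
      using GR[OF i] B_ball(2)[OF i] by blast+
    ultimately have "ennreal (measure lborel (B i - G i) * measure lborel (G i - B i)) \<le> ennreal (\<eta> * V)"
      using V \<eta> by (simp only: fm emV ennreal_mult measure_nonneg less_imp_le)
    then have *: "measure lborel (B i - G i) * measure lborel (G i - B i) \<le> \<eta> * V"
      using V \<eta> by (subst (asm) ennreal_le_iff) auto
    have fin: "emeasure lborel (G i) \<noteq> \<infinity>" "emeasure lborel (B i) \<noteq> \<infinity>"
      using finR[OF GR[OF i]] finR[OF B_ball(2)[OF i]] by simp_all
    have "measure lborel (G i) = measure lborel (B i)"
      using GA[OF i] emB[of i] by (simp add: measure_def)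
    moreover have "measure lborel (G i - G i \<inter> B i) = measure lborel (G i) - measure lborel (G i \<inter> B i)"
      "measure lborel (B i - G i \<inter> B i) = measure lborel (B i) - measure lborel (G i \<inter> B i)"
      using fin Gi[OF i] by (intro measure_Diff; simp)+
    moreover have "G i - G i \<inter> B i = G i - B i" "B i - G i \<inter> B i = B i - G i" by blast+
    ultimately have "measure lborel (B i - G i) = measure lborel (G i - B i)"
      by simp
    with * have "(measure lborel (G i - B i))\<^sup>2 \<le> \<epsilon>\<^sup>2"
      using V by (simp add: \<eta>_def power2_eq_square)
    then show ?thesis by (rule power2_le_imp_le) (use \<epsilon> in simp)
  qed
  then have deficit: "measure lborel (G i - centered_ball (emeasure lborel (A i))) \<le> \<epsilon>" if "i < 3" for i
    using that by (simp add: B_def)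
  have "riesz (indicator (A 0)) (indicator (A 1)) (indicator (A 2))
      \<le> riesz (indicator (G 0)) (indicator (G 1)) (indicator (G 2))"
    using G(1) by (simp add: T_def)
  then show ?thesis using Gi GA deficit by (intro exI[of _ G]) simp
qed

lemma riesz_mono:
  assumes "\<And>x. f x \<le> f' x" "\<And>x. g x \<le> g' x" "\<And>x. h x \<le> h' x"
  shows "riesz f g h \<le> riesz f' g' h'"
  unfolding riesz_def by (intro nn_integral_mono mult_mono assms zero_le)

lemma riesz_indicator_perturb:
  fixes A A' B B' C C' :: "'a::euclidean_space set"
  assumes [measurable]: "A \<in> sets borel" "A' \<in> sets borel" "B \<in> sets borel" "B' \<in> sets borel"
      "C \<in> sets borel" "C' \<in> sets borel"
  shows "riesz (indicator A) (indicator B) (indicator C)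
     \<le> riesz (indicator A') (indicator B') (indicator C')
      + (emeasure lborel (A - A') * emeasure lborel B + emeasure lborel A' * emeasure lborel (B - B')
        + emeasure lborel A' * emeasure lborel (C - C'))"
proof -
  let ?i = "indicator :: 'a set \<Rightarrow> 'a \<Rightarrow> ennreal"
  have "riesz (?i A) (?i B) (?i C)
     \<le> (\<integral>\<^sup>+x. \<integral>\<^sup>+y. ?i A' x * ?i B' y * ?i C' (x + y) +
      (?i (A - A') x * ?i B y + ?i A' x * ?i (B - B') y + ?i A' x * ?i (C - C') (x + y)) \<partial>lborel \<partial>lborel)"
    unfolding riesz_def by (intro nn_integral_mono) (auto simp: indicator_def)
  also have "\<dots> = riesz (?i A') (?i B') (?i C') + ((\<integral>\<^sup>+x. \<integral>\<^sup>+y. ?i (A - A') x * ?i B y \<partial>lborel \<partial>lborel)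
     + (\<integral>\<^sup>+x. \<integral>\<^sup>+y. ?i A' x * ?i (B - B') y \<partial>lborel \<partial>lborel)
     + (\<integral>\<^sup>+x. \<integral>\<^sup>+y. ?i A' x * ?i (C - C') (x + y) \<partial>lborel \<partial>lborel))"
    unfolding riesz_def by (simp add: nn_integral_add)
  also have "(\<integral>\<^sup>+x. \<integral>\<^sup>+y. ?i A' x * ?i (C - C') (x + y) \<partial>lborel \<partial>lborel)
     = (\<integral>\<^sup>+x. ?i A' x * emeasure lborel (C - C') \<partial>lborel)"
  proof (rule nn_integral_cong)
    fix x
    have "(\<integral>\<^sup>+y. ?i (C - C') (x + y) \<partial>lborel) = emeasure lborel (C - C')"
      using nn_integral_lborel_translate[of "?i (C - C')" x] by (simp add: add.commute)
    then show "(\<integral>\<^sup>+y. ?i A' x * ?i (C - C') (x + y) \<partial>lborel) = ?i A' x * emeasure lborel (C - C')"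
      by (simp add: nn_integral_cmult)
  qed
  finally show ?thesis
    by (simp add: nn_integral_cmult nn_integral_multc)
qed

lemma riesz_bounded_sets:
  fixes A :: "nat \<Rightarrow> 'a::euclidean_space set"
  assumes A: "\<And>i. i < 3 \<Longrightarrow> A i \<in> sets borel" "\<And>i. i < 3 \<Longrightarrow> A i \<subseteq> ball 0 R" and R: "0 < R"
  shows "riesz (indicator (A 0)) (indicator (A 1)) (indicator (A 2))
    \<le> riesz (indicator (centered_ball (emeasure lborel (A 0)) :: 'a set))
       (indicator (centered_ball (emeasure lborel (A 1)))) (indicator (centered_ball (emeasure lborel (A 2))))"
    (is "_ \<le> ?rhs")
proof (rule ennreal_le_epsilon)
  fix e :: real assume e: "0 < e"
  define m where "m i = measure lborel (A i)" for i
  have m: "emeasure lborel (A i) = ennreal (m i)" if "i < 3" for i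
  proof -
    have "emeasure lborel (A i) \<le> emeasure lborel (ball (0::'a) R)"
      using A[OF that] by (intro emeasure_mono) auto
    then have "emeasure lborel (A i) < \<infinity>"
      using emeasure_lborel_ball_finite[of "0::'a" R] by (rule le_less_trans)
    then have "emeasure lborel (A i) \<noteq> \<top>" by simp
    then show ?thesis unfolding m_def by (rule emeasure_eq_ennreal_measure)
  qed
  have m0: "0 \<le> m i" for i by (simp add: m_def)
  define \<epsilon> where "\<epsilon> = e / (m 1 + m 0 + m 0 + 1)"
  have \<epsilon>: "0 < \<epsilon>" using e m0[of 0] m0[of 1] by (simp add: \<epsilon>_def)
  have "\<exists>G :: nat \<Rightarrow> 'a set.
    (\<forall>i<3. G i \<in> sets borel \<and> emeasure lborel (G i) = emeasure lborel (A i) \<and>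
       measure lborel (G i - centered_ball (emeasure lborel (A i))) \<le> \<epsilon>) \<and>
    riesz (indicator (A 0)) (indicator (A 1)) (indicator (A 2))
      \<le> riesz (indicator (G 0)) (indicator (G 1)) (indicator (G 2))"
    by (rule approximate_by_symmetrization[where R=R]) (use A R \<epsilon> in auto)
  then obtain G :: "nat \<Rightarrow> 'a set" where G_all: "\<forall>i<3. G i \<in> sets borel \<and>
       emeasure lborel (G i) = emeasure lborel (A i) \<and>
       measure lborel (G i - centered_ball (emeasure lborel (A i))) \<le> \<epsilon>"
    and G_riesz: "riesz (indicator (A 0)) (indicator (A 1)) (indicator (A 2))
      \<le> riesz (indicator (G 0)) (indicator (G 1)) (indicator (G 2))"
    by (elim exE conjE)
  have G: "G i \<in> sets borel" "emeasure lborel (G i) = emeasure lborel (A i)"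
    "measure lborel (G i - centered_ball (emeasure lborel (A i))) \<le> \<epsilon>" if "i < 3" for i
    using G_all that by simp_all
  let ?B = "\<lambda>i. centered_ball (emeasure lborel (A i)) :: 'a set"
  have dev: "emeasure lborel (G i - ?B i) \<le> ennreal \<epsilon>" if "i < 3" for i
  proof -
    have "emeasure lborel (G i - ?B i) \<le> emeasure lborel (G i)"
      using G(1)[OF that] by (intro emeasure_mono) auto
    also have "\<dots> < \<top>" using G(2)[OF that] m[OF that] by simp
    finally show ?thesis
      using G(3)[OF that] by (simp add: emeasure_eq_ennreal_measure ennreal_leI)
  qed
  note G_riesz
  also have "riesz (indicator (G 0)) (indicator (G 1)) (indicator (G 2))
    \<le> ?rhs + (emeasure lborel (G 0 - ?B 0) * emeasure lborel (G 1) + emeasure lborel (?B 0) * emeasure lborel (G 1 - ?B 1)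
        + emeasure lborel (?B 0) * emeasure lborel (G 2 - ?B 2))"
    by (rule riesz_indicator_perturb) (simp_all add: G(1))
  also have "\<dots> \<le> ?rhs + (ennreal \<epsilon> * ennreal (m 1) + ennreal (m 0) * ennreal \<epsilon> + ennreal (m 0) * ennreal \<epsilon>)"
    using dev by (intro add_mono mult_mono order_refl) (simp_all add: G(2) m)
  also have "ennreal \<epsilon> * ennreal (m 1) + ennreal (m 0) * ennreal \<epsilon> + ennreal (m 0) * ennreal \<epsilon>
     = ennreal (\<epsilon> * (m 1 + m 0 + m 0))"
    using \<epsilon> m0 by (simp add: algebra_simps flip: ennreal_mult ennreal_plus)
  also have "\<dots> \<le> ennreal e"
    using e m0[of 0] m0[of 1] by (intro ennreal_leI) (simp add: \<epsilon>_def field_simps)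
  finally show "riesz (indicator (A 0)) (indicator (A 1)) (indicator (A 2)) \<le> ?rhs + ennreal e"
    by (simp add: add_left_mono)
qed

lemma riesz_bounded_support:
  fixes f g h :: "'a::euclidean_space \<Rightarrow> ennreal"
  assumes [measurable]: "f \<in> borel_measurable borel" "g \<in> borel_measurable borel" "h \<in> borel_measurable borel"
    and le1: "\<And>x. f x \<le> 1" "\<And>x. g x \<le> 1" "\<And>x. h x \<le> 1"
    and supp: "\<And>x. R \<le> norm x \<Longrightarrow> f x = 0" "\<And>x. R \<le> norm x \<Longrightarrow> g x = 0" "\<And>x. R \<le> norm x \<Longrightarrow> h x = 0"
    and R: "0 < R"
  shows "riesz f g h \<le> riesz (indicator (centered_ball (integral\<^sup>N lborel f) :: 'a set))
     (indicator (centered_ball (integral\<^sup>N lborel g))) (indicator (centered_ball (integral\<^sup>N lborel h)))"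
proof -
  \<comment> \<open>one symmetrization, in any direction, turns the functions into sets\<close>
  obtain u :: 'a where u: "norm u = 1" using norm_Basis SOME_Basis by blast
  define F where "F i = (if i = 0 then f else if i = 1 then g else h)" for i :: nat
  have F: "F i \<in> borel_measurable borel" "F i x \<le> 1" "R \<le> norm x \<Longrightarrow> F i x = 0" for i x
    using assms by (auto simp: F_def)
  have "riesz f g h \<le> riesz (indicator (steiner u (F 0))) (indicator (steiner u (F 1))) (indicator (steiner u (F 2)))"
    unfolding F_def by (simp, rule riesz_steiner[where R=R]) (use assms u in auto)
  also have "\<dots> \<le> riesz (indicator (centered_ball (emeasure lborel (steiner u (F 0))) :: 'a set))
     (indicator (centered_ball (emeasure lborel (steiner u (F 1)))))
     (indicator (centered_ball (emeasure lborel (steiner u (F 2)))))"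
    using F u R by (intro riesz_bounded_sets[where R=R] steiner_subset_ball) auto
  finally show ?thesis by (simp add: emeasure_steiner F u) (simp add: F_def)
qed

text \<open>The Riesz rearrangement inequality for functions with values in the unit interval, each replaced by the
  indicator of the centred ball whose measure is the integral of the function.\<close>

theorem riesz_rearrangement:
  fixes f g h :: "'a::euclidean_space \<Rightarrow> ennreal"
  assumes [measurable]: "f \<in> borel_measurable borel" "g \<in> borel_measurable borel" "h \<in> borel_measurable borel"
    and le1: "\<And>x. f x \<le> 1" "\<And>x. g x \<le> 1" "\<And>x. h x \<le> 1"
  shows "riesz f g h \<le> riesz (indicator (centered_ball (integral\<^sup>N lborel f) :: 'a set))
     (indicator (centered_ball (integral\<^sup>N lborel g))) (indicator (centered_ball (integral\<^sup>N lborel h)))"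
    (is "_ \<le> ?rhs")
proof -
  define c :: "('a \<Rightarrow> ennreal) \<Rightarrow> nat \<Rightarrow> 'a \<Rightarrow> ennreal"
    where "c p k x = p x * indicator (ball (0::'a) (real (Suc k))) x" for p k x
  have [measurable]: "c p k \<in> borel_measurable borel" if "p \<in> borel_measurable borel" for p k
    using that unfolding c_def by (intro borel_measurable_times_ennreal borel_measurable_indicator) auto
  have c_le: "c p k x \<le> p x" for p k x by (simp add: c_def indicator_def)
  have c_mono: "c p k x \<le> c p l x" if "k \<le> l" for p k l x
    using that by (auto simp: c_def indicator_def)
  let ?F = "\<lambda>k x y. c f k x * c g k y * c h k (x + y)"
  have sup: "f x * g y * h (x + y) = (SUP k. ?F k x y)" for x y
  proof (rule antisym)
    obtain k where k: "norm x + norm y < real k" using reals_Archimedean2 by blast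
    have "norm x < real (Suc k)" "norm y < real (Suc k)" "norm (x + y) < real (Suc k)"
      using k norm_triangle_ineq[of x y] norm_ge_zero[of x] norm_ge_zero[of y] by linarith+
    then have "f x * g y * h (x + y) = ?F k x y" by (simp add: c_def)
    also have "\<dots> \<le> (SUP k. ?F k x y)" by (rule SUP_upper) simp
    finally show "f x * g y * h (x + y) \<le> (SUP k. ?F k x y)" .
    show "(SUP k. ?F k x y) \<le> f x * g y * h (x + y)"
      by (intro SUP_least mult_mono c_le zero_le)
  qed
  have "riesz f g h = (\<integral>\<^sup>+x. (\<integral>\<^sup>+y. (SUP k. ?F k x y) \<partial>lborel) \<partial>lborel)"
    unfolding riesz_def sup ..
  also have "\<dots> = (\<integral>\<^sup>+x. (SUP k. \<integral>\<^sup>+y. ?F k x y \<partial>lborel) \<partial>lborel)"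
    by (intro nn_integral_cong nn_integral_monotone_convergence_SUP)
       (auto simp: incseq_def le_fun_def intro!: mult_mono c_mono)
  also have "\<dots> = (SUP k. riesz (c f k) (c g k) (c h k))"
    unfolding riesz_def
    by (intro nn_integral_monotone_convergence_SUP)
       (auto simp: incseq_def le_fun_def intro!: mult_mono c_mono nn_integral_mono)
  also have "\<dots> \<le> ?rhs"
  proof (rule SUP_least)
    fix k
    have c1: "c p k x \<le> 1" if "\<And>x. p x \<le> 1" for p x using c_le that order_trans by blast
    have "riesz (c f k) (c g k) (c h k) \<le> riesz (indicator (centered_ball (integral\<^sup>N lborel (c f k)) :: 'a set))
     (indicator (centered_ball (integral\<^sup>N lborel (c g k)))) (indicator (centered_ball (integral\<^sup>N lborel (c h k))))"
      by (rule riesz_bounded_support[where R="real (Suc k)"]) (auto simp: c1 le1, auto simp: c_def)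
    also have "\<dots> \<le> ?rhs"
    proof -
      have "indicator (centered_ball (integral\<^sup>N lborel (c p k))) x
          \<le> (indicator (centered_ball (integral\<^sup>N lborel p)) x :: ennreal)" for p and x :: 'a
        using centered_ball_mono[OF nn_integral_mono[of lborel "c p k" p]] c_le
        by (auto simp: indicator_def)
      then show ?thesis by (intro riesz_mono)
    qed
    finally show "riesz (c f k) (c g k) (c h k) \<le> ?rhs" .
  qed
  finally show ?thesis .
qed

section \<open>Domination by a radially decreasing function\<close>

text \<open>\<open>g\<close> dominates \<open>f\<close> if no set captures more mass of \<open>f\<close> than the centred ball of the same measure captures
  of \<open>g\<close>. For radially decreasing \<open>g\<close> this is weak majorization between the decreasing
  rearrangements of \<open>f\<close> and \<open>g\<close>.\<close>

definition dominated :: "('a::euclidean_space \<Rightarrow> ennreal) \<Rightarrow> ('a \<Rightarrow> ennreal) \<Rightarrow> bool" where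
  "dominated f g \<longleftrightarrow> (\<forall>W\<in>sets borel. (\<integral>\<^sup>+x. f x * indicator W x \<partial>lborel)
     \<le> (\<integral>\<^sup>+x. g x * indicator (centered_ball (emeasure lborel W)) x \<partial>lborel))"

lemma dominatedD:
  "dominated f g \<Longrightarrow> W \<in> sets borel \<Longrightarrow> (\<integral>\<^sup>+x. f x * indicator W x \<partial>lborel)
     \<le> (\<integral>\<^sup>+x. g x * indicator (centered_ball (emeasure lborel W)) x \<partial>lborel)"
  by (simp add: dominated_def)

lemma dominated_integral_le: "dominated f g \<Longrightarrow> integral\<^sup>N lborel f \<le> integral\<^sup>N lborel g"
  using dominatedD[of f g UNIV] by (simp add: emeasure_lborel_UNIV)

lemma centered_ball_Int: "centered_ball m \<inter> centered_ball m' = centered_ball (min m m')"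
  by (auto simp: centered_ball_def)

lemma dominated_indicator:
  assumes [measurable]: "S \<in> sets borel"
  shows "dominated (indicator S) (indicator (centered_ball (emeasure lborel S)))"
proof -
  have "emeasure lborel (S \<inter> W) \<le> min (emeasure lborel S) (emeasure lborel W)" if "W \<in> sets borel" for W
    using that by (simp add: emeasure_mono)
  then show ?thesis
    by (simp add: dominated_def centered_ball_Int flip: indicator_inter_arith)
qed

lemma dominated_bounded_density:
  fixes f :: "'a::euclidean_space \<Rightarrow> ennreal"
  assumes [measurable]: "f \<in> borel_measurable borel"
    and fK: "\<And>x. f x \<le> ennreal K" and f1: "integral\<^sup>N lborel f \<le> 1" and K: "0 < K"
  shows "dominated f (\<lambda>x. ennreal K * indicator (centered_ball (ennreal (1 / K))) x)"
  unfolding dominated_def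
proof
  fix W :: "'a set" assume [measurable]: "W \<in> sets borel"
  have "(\<integral>\<^sup>+x. f x * indicator W x \<partial>lborel) \<le> ennreal K * min (ennreal (1 / K)) (emeasure lborel W)"
  proof (cases "ennreal (1 / K) \<le> emeasure lborel W")
    case True
    have "(\<integral>\<^sup>+x. f x * indicator W x \<partial>lborel) \<le> integral\<^sup>N lborel f"
      by (intro nn_integral_mono) (auto simp: indicator_def)
    with f1 True K show ?thesis by (simp add: min_def flip: ennreal_mult)
  next
    case False
    have "(\<integral>\<^sup>+x. f x * indicator W x \<partial>lborel) \<le> (\<integral>\<^sup>+x. ennreal K * indicator W x \<partial>lborel)"
      by (intro nn_integral_mono mult_right_mono fK) auto
    with False show ?thesis by (simp add: min_def nn_integral_cmult_indicator)
  qed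
  also have "\<dots> = (\<integral>\<^sup>+x. ennreal K * indicator (centered_ball (ennreal (1 / K))) x *
      indicator (centered_ball (emeasure lborel W) :: 'a set) x \<partial>lborel)"
    by (simp add: mult.assoc centered_ball_Int nn_integral_cmult_indicator flip: indicator_inter_arith)
  finally show "(\<integral>\<^sup>+x. f x * indicator W x \<partial>lborel) \<le> \<dots>" .
qed

text \<open>For \<open>c > 0\<close>, domination is tested on the superlevel set of \<open>f\<close> at height \<open>c\<close>.\<close>

lemma dominated_excess:
  fixes f g :: "'a::euclidean_space \<Rightarrow> ennreal"
  assumes [measurable]: "f \<in> borel_measurable borel" "g \<in> borel_measurable borel"
    and dom: "dominated f g" and fin: "integral\<^sup>N lborel g < \<infinity>" and c: "0 \<le> c"
  shows "(\<integral>\<^sup>+x. f x - ennreal c \<partial>lborel) \<le> (\<integral>\<^sup>+x. g x - ennreal c \<partial>lborel)"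
proof (cases "c = 0")
  case True
  then show ?thesis using dominated_integral_le[OF dom] by simp
next
  case False
  define W where "W = {x. ennreal c < f x}"
  have [measurable]: "W \<in> sets borel"
  proof -
    have "{x \<in> space borel. ennreal c < f x} \<in> sets borel" by measurable
    then show ?thesis by (simp add: W_def)
  qed
  let ?m = "emeasure lborel W"
  have "ennreal c * ?m = (\<integral>\<^sup>+x. ennreal c * indicator W x \<partial>lborel)"
    by (simp add: nn_integral_cmult_indicator)
  also have "\<dots> \<le> integral\<^sup>N lborel f"
    by (intro nn_integral_mono) (auto simp: W_def indicator_def)
  also have "\<dots> < \<infinity>" using dominated_integral_le[OF dom] fin by (rule le_less_trans)
  finally have m_fin: "ennreal c * ?m < \<infinity>" .
  have "(\<integral>\<^sup>+x. f x - ennreal c \<partial>lborel) + ennreal c * ?m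
      = (\<integral>\<^sup>+x. (f x - ennreal c) + ennreal c * indicator W x \<partial>lborel)"
    by (simp add: nn_integral_add nn_integral_cmult_indicator)
  also have "\<dots> = (\<integral>\<^sup>+x. f x * indicator W x \<partial>lborel)"
  proof (rule nn_integral_cong)
    fix x
    show "(f x - ennreal c) + ennreal c * indicator W x = f x * indicator W x"
      by (cases "x \<in> W") (auto simp: W_def not_less diff_eq_0_ennreal le_less_trans diff_add_self_ennreal)
  qed
  also have "\<dots> \<le> (\<integral>\<^sup>+x. g x * indicator (centered_ball ?m) x \<partial>lborel)"
    using dom by (rule dominatedD) measurable
  also have "\<dots> \<le> (\<integral>\<^sup>+x. (g x - ennreal c) + ennreal c * indicator (centered_ball ?m) x \<partial>lborel)"
  proof (rule nn_integral_mono)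
    fix x
    show "g x * indicator (centered_ball ?m) x \<le> (g x - ennreal c) + ennreal c * indicator (centered_ball ?m) x"
      by (cases "x \<in> centered_ball ?m") (auto simp: diff_add_self_ennreal)
  qed
  also have "\<dots> = (\<integral>\<^sup>+x. g x - ennreal c \<partial>lborel) + ennreal c * ?m"
    by (simp add: nn_integral_add nn_integral_cmult_indicator)
  finally show ?thesis using m_fin by (metis ennreal_add_left_cancel_le add.commute infinity_ennreal_def less_irrefl)
qed

text \<open>For finite \<open>m\<close>, \<open>c\<close> is the value of \<open>f\<close> on the boundary sphere of the ball.\<close>

lemma radial_decreasing_split_ball:
  fixes f :: "'a::euclidean_space \<Rightarrow> ennreal"
  assumes [measurable]: "f \<in> borel_measurable borel" 
    and rad: "radial_decreasing f" and fin: "\<And>x. f x < \<infinity>"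
  obtains c where "0 \<le> c" "(\<integral>\<^sup>+x. f x * indicator (centered_ball m) x \<partial>lborel)
     = ennreal c * m + (\<integral>\<^sup>+x. f x - ennreal c \<partial>lborel)"
proof (cases "m = \<infinity>")
  case True
  then show ?thesis using that[of 0] by simp
next
  case False
  then obtain r where r: "0 \<le> r" "centered_ball m = ball (0::'a) r" by (rule centered_ball_obtain)
  obtain e :: 'a where e: "norm e = 1" using norm_Basis SOME_Basis by blast
  define c where "c = enn2real (f (r *\<^sub>R e))"
  have c: "ennreal c = f (r *\<^sub>R e)" "0 \<le> c" using fin[of "r *\<^sub>R e"] by (simp_all add: c_def)
  have ge: "ennreal c \<le> f x" if "x \<in> centered_ball m" for x
    using that r e unfolding c by (intro radial_decreasingD[OF rad]) simp
  have le: "f x \<le> ennreal c" if "x \<notin> centered_ball m" for x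
    using that r e unfolding c by (intro radial_decreasingD[OF rad]) simp
  have "(\<integral>\<^sup>+x. f x * indicator (centered_ball m) x \<partial>lborel)
     = (\<integral>\<^sup>+x. ennreal c * indicator (centered_ball m) x + (f x - ennreal c) \<partial>lborel)"
  proof (rule nn_integral_cong)
    fix x
    show "f x * indicator (centered_ball m) x = ennreal c * indicator (centered_ball m) x + (f x - ennreal c)"
      using ge[of x] le[of x] fin[of x]
      by (cases "x \<in> centered_ball m") (auto simp: add_diff_self_ennreal diff_eq_0_ennreal)
  qed
  also have "\<dots> = ennreal c * m + (\<integral>\<^sup>+x. f x - ennreal c \<partial>lborel)"
    by (simp add: nn_integral_add nn_integral_cmult_indicator)
  finally show ?thesis using that c(2) by blast
qed

text \<open>The layer cake kernel: integrating \<open>above t y\<close> over real \<open>t\<close> gives \<open>y\<close>.\<close>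

definition above :: "real \<Rightarrow> ennreal \<Rightarrow> ennreal" where
  "above t y = (if 0 < t \<and> ennreal t < y then 1 else 0)"

lemma measurable_above [measurable]: "(\<lambda>(t, y). above t y) \<in> borel_measurable (borel \<Otimes>\<^sub>M borel)"
  unfolding above_def by measurable

lemma nn_integral_above_gt:
  assumes "0 \<le> c"
  shows "(\<integral>\<^sup>+t. above t y * indicator {c<..} t \<partial>lborel) = y - ennreal c"
proof (cases y)
  case (real r)
  have "(\<integral>\<^sup>+t. above t y * indicator {c<..} t \<partial>lborel) = (\<integral>\<^sup>+t. indicator {c<..<r} t \<partial>lborel)"
    using assms real by (intro nn_integral_cong) (auto simp: above_def indicator_def ennreal_less_iff)
  also have "\<dots> = ennreal (r - c)" by (cases "c \<le> r") (auto simp: ennreal_neg)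
  finally show ?thesis using assms real by (simp add: ennreal_minus)
next
  case top
  have "(\<integral>\<^sup>+t. above t y * indicator {c<..} t \<partial>lborel) = (\<integral>\<^sup>+t. indicator {c<..} t \<partial>lborel)"
    using assms top by (intro nn_integral_cong) (auto simp: above_def indicator_def)
  also have "\<dots> = \<top>"
  proof (rule ccontr)
    assume "(\<integral>\<^sup>+t. indicator {c<..} t \<partial>lborel) \<noteq> \<top>"
    then obtain n :: nat where "emeasure lborel {c<..} < of_nat n"
      using ennreal_Ex_less_of_nat by (auto simp: less_top)
    moreover have "emeasure lborel {c<..<c + real n} \<le> emeasure lborel {c<..}"
      by (intro emeasure_mono) auto
    ultimately show False by (simp add: ennreal_of_nat_eq_real_of_nat)
  qed
  finally show ?thesis using top by simp
qed

lemma nn_integral_above: "(\<integral>\<^sup>+t. above t y \<partial>lborel) = y"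
proof -
  have "above t y * indicator {0<..} t = above t y" for t by (simp add: above_def)
  then show ?thesis using nn_integral_above_gt[of 0 y] by simp
qed

lemma layer_cake:
  fixes f g :: "'a::euclidean_space \<Rightarrow> ennreal"
  assumes [measurable]: "f \<in> borel_measurable borel" "g \<in> borel_measurable borel"
  shows "(\<integral>\<^sup>+x. f x * g x \<partial>lborel) = (\<integral>\<^sup>+t. \<integral>\<^sup>+x. above t (f x) * g x \<partial>lborel \<partial>lborel)"
proof -
  have "(\<integral>\<^sup>+x. f x * g x \<partial>lborel) = (\<integral>\<^sup>+x. (\<integral>\<^sup>+t. above t (f x) \<partial>lborel) * g x \<partial>lborel)"
    by (simp only: nn_integral_above)
  also have "\<dots> = (\<integral>\<^sup>+x. \<integral>\<^sup>+t. above t (f x) * g x \<partial>lborel \<partial>lborel)"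
    by (intro nn_integral_cong nn_integral_multc[symmetric]) measurable
  also have "\<dots> = (\<integral>\<^sup>+t. \<integral>\<^sup>+x. above t (f x) * g x \<partial>lborel \<partial>lborel)"
    by (rule lborel_Fubini) measurable
  finally show ?thesis .
qed

lemma layer_cake_excess:
  fixes f :: "'a::euclidean_space \<Rightarrow> ennreal"
  assumes [measurable]: "f \<in> borel_measurable borel" and c: "0 \<le> c"
  shows "(\<integral>\<^sup>+x. f x - ennreal c \<partial>lborel) = (\<integral>\<^sup>+t. (\<integral>\<^sup>+x. above t (f x) \<partial>lborel) * indicator {c<..} t \<partial>lborel)"
proof -
  have "(\<integral>\<^sup>+x. f x - ennreal c \<partial>lborel) = (\<integral>\<^sup>+x. \<integral>\<^sup>+t. above t (f x) * indicator {c<..} t \<partial>lborel \<partial>lborel)"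
    by (simp only: nn_integral_above_gt[OF c])
  also have "\<dots> = (\<integral>\<^sup>+t. \<integral>\<^sup>+x. above t (f x) * indicator {c<..} t \<partial>lborel \<partial>lborel)"
    by (rule lborel_Fubini) measurable
  also have "\<dots> = (\<integral>\<^sup>+t. (\<integral>\<^sup>+x. above t (f x) \<partial>lborel) * indicator {c<..} t \<partial>lborel)"
    by (intro nn_integral_cong nn_integral_multc) measurable
  finally show ?thesis .
qed

lemma centered_ball_subset_down_closed:
  fixes E :: "'a::euclidean_space set"
  assumes "\<And>x y::'a. x \<in> E \<Longrightarrow> norm y \<le> norm x \<Longrightarrow> y \<in> E"
  shows "centered_ball (emeasure lborel E) \<subseteq> E"
proof
  fix x :: 'a assume x: "x \<in> centered_ball (emeasure lborel E)"
  show "x \<in> E"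
  proof (rule ccontr)
    assume "x \<notin> E"
    then have "norm y < norm x" if "y \<in> E" for y using that assms[OF that, of x] by force
    then have "E \<subseteq> ball 0 (norm x)" by auto
    then have "emeasure lborel E \<le> emeasure lborel (ball (0::'a) (norm x))" by (intro emeasure_mono) auto
    then show False using x by (simp add: centered_ball_def)
  qed
qed

text \<open>The Hardy--Littlewood inequality combined with majorization. In the proof \<open>P\<close> is the symmetric decreasing
  rearrangement of \<open>p\<close>: domination of \<open>q\<close> on the superlevel sets of \<open>p\<close> allows passing from \<open>p\<close>, \<open>q\<close> to
  \<open>P\<close>, \<open>q'\<close>, and then \<open>P\<close> is compared with \<open>p'\<close> on the superlevel sets of \<open>q'\<close>.\<close>

lemma nn_integral_mult_le_of_dominated:
  fixes p p' q q' :: "'a::euclidean_space \<Rightarrow> ennreal"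
  assumes [measurable]: "p \<in> borel_measurable borel" "p' \<in> borel_measurable borel"
      "q \<in> borel_measurable borel" "q' \<in> borel_measurable borel"
    and p: "dominated p p'" and q: "dominated q q'"
    and p': "radial_decreasing p'" and q': "radial_decreasing q'"
    and fin: "\<And>x. p' x < \<infinity>" "integral\<^sup>N lborel p' < \<infinity>"
  shows "(\<integral>\<^sup>+x. p x * q x \<partial>lborel) \<le> (\<integral>\<^sup>+x. p' x * q' x \<partial>lborel)"
proof -
  define w where "w t = (\<integral>\<^sup>+x. above t (p x) \<partial>lborel)" for t
  have [measurable]: "w \<in> borel_measurable borel" unfolding w_def by measurable
  \<comment> \<open>the superlevel sets of \<open>p\<close>, each replaced by the centred ball of the same measure\<close>
  define J :: "real \<Rightarrow> 'a \<Rightarrow> ennreal" where "J t = indicator (centered_ball (w t))" for t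
  have J: "J t x = (if emeasure lborel (ball (0::'a) (norm x)) < w t then 1 else 0)" for t x
    by (simp add: J_def centered_ball_def indicator_def)
  have [measurable]: "case_prod J \<in> borel_measurable (borel \<Otimes>\<^sub>M borel)"
    unfolding J emeasure_ball[OF norm_ge_zero] by measurable
  define P where "P x = (\<integral>\<^sup>+t. J t x \<partial>lborel)" for x
  have [measurable]: "P \<in> borel_measurable borel" unfolding P_def by measurable
  have "(\<integral>\<^sup>+x. p x * q x \<partial>lborel) = (\<integral>\<^sup>+t. \<integral>\<^sup>+x. above t (p x) * q x \<partial>lborel \<partial>lborel)"
    by (rule layer_cake) measurable
  also have "\<dots> \<le> (\<integral>\<^sup>+t. \<integral>\<^sup>+x. J t x * q' x \<partial>lborel \<partial>lborel)"
  proof (rule nn_integral_mono)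
    fix t
    define W where "W = {x. 0 < t \<and> ennreal t < p x}"
    have [measurable]: "W \<in> sets borel"
    proof -
      have "{x \<in> space borel. 0 < t \<and> ennreal t < p x} \<in> sets borel" by measurable
      then show ?thesis by (simp add: W_def)
    qed
    have W: "above t (p x) = indicator W x" for x by (simp add: above_def W_def indicator_def)
    have "w t = emeasure lborel W" by (simp add: w_def W)
    then show "(\<integral>\<^sup>+x. above t (p x) * q x \<partial>lborel) \<le> (\<integral>\<^sup>+x. J t x * q' x \<partial>lborel)"
      using dominatedD[OF q, of W] by (simp add: W J_def mult.commute)
  qed
  also have "\<dots> = (\<integral>\<^sup>+x. \<integral>\<^sup>+t. J t x * q' x \<partial>lborel \<partial>lborel)"
    by (rule lborel_Fubini) measurable
  also have "\<dots> = (\<integral>\<^sup>+x. P x * q' x \<partial>lborel)"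
    unfolding P_def by (intro nn_integral_cong nn_integral_multc) measurable
  also have "\<dots> = (\<integral>\<^sup>+s. \<integral>\<^sup>+x. above s (q' x) * P x \<partial>lborel \<partial>lborel)"
    by (subst layer_cake[symmetric]) (simp_all add: mult.commute)
  also have "\<dots> \<le> (\<integral>\<^sup>+s. \<integral>\<^sup>+x. above s (q' x) * p' x \<partial>lborel \<partial>lborel)"
  proof (rule nn_integral_mono)
    fix s
    define E where "E = {x. 0 < s \<and> ennreal s < q' x}"
    have [measurable]: "E \<in> sets borel"
    proof -
      have "{x \<in> space borel. 0 < s \<and> ennreal s < q' x} \<in> sets borel" by measurable
      then show ?thesis by (simp add: E_def)
    qed
    have E: "above s (q' x) = indicator E x" for x by (simp add: above_def E_def indicator_def)
    let ?m = "emeasure lborel E"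
    obtain c where c: "0 \<le> c" "(\<integral>\<^sup>+x. p' x * indicator (centered_ball ?m) x \<partial>lborel)
        = ennreal c * ?m + (\<integral>\<^sup>+x. p' x - ennreal c \<partial>lborel)"
      using radial_decreasing_split_ball[OF _ p' fin(1)] by auto
    have "(\<integral>\<^sup>+x. above s (q' x) * P x \<partial>lborel) = (\<integral>\<^sup>+x. \<integral>\<^sup>+t. indicator E x * J t x \<partial>lborel \<partial>lborel)"
      unfolding P_def E by (intro nn_integral_cong nn_integral_cmult[symmetric]) measurable
    also have "\<dots> = (\<integral>\<^sup>+t. \<integral>\<^sup>+x. indicator E x * J t x \<partial>lborel \<partial>lborel)"
      by (rule lborel_Fubini) measurable
    also have "\<dots> \<le> (\<integral>\<^sup>+t. ?m * indicator {0<..c} t + w t * indicator {c<..} t \<partial>lborel)"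
    proof (rule nn_integral_mono)
      fix t
      have eq: "(\<integral>\<^sup>+x. indicator E x * J t x \<partial>lborel) = emeasure lborel (E \<inter> centered_ball (w t))"
        by (simp add: J_def flip: indicator_inter_arith)
      have "emeasure lborel (E \<inter> centered_ball (w t)) \<le> ?m" by (intro emeasure_mono) auto
      moreover have "emeasure lborel (E \<inter> centered_ball (w t)) \<le> w t"
        using emeasure_mono[of "E \<inter> centered_ball (w t)" "centered_ball (w t)" lborel] by simp
      moreover have "w t = 0" if "t \<le> 0" using that by (simp add: w_def above_def)
      ultimately show "(\<integral>\<^sup>+x. indicator E x * J t x \<partial>lborel) \<le> ?m * indicator {0<..c} t + w t * indicator {c<..} t"
        unfolding eq by (auto simp: indicator_def not_le not_less)
    qed
    also have "\<dots> = ennreal c * ?m + (\<integral>\<^sup>+x. p x - ennreal c \<partial>lborel)"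
      using c(1) by (simp add: nn_integral_add nn_integral_cmult_indicator layer_cake_excess w_def mult.commute)
    also have "\<dots> \<le> ennreal c * ?m + (\<integral>\<^sup>+x. p' x - ennreal c \<partial>lborel)"
      using c(1) p fin(2) by (intro add_left_mono dominated_excess) auto
    also have "\<dots> = (\<integral>\<^sup>+x. p' x * indicator (centered_ball ?m) x \<partial>lborel)"
      by (rule c(2)[symmetric])
    also have "\<dots> \<le> (\<integral>\<^sup>+x. above s (q' x) * p' x \<partial>lborel)"
    proof (rule nn_integral_mono)
      fix x
      have "centered_ball ?m \<subseteq> E"
        by (rule centered_ball_subset_down_closed)
           (use radial_decreasingD[OF q'] in \<open>auto simp: E_def intro: less_le_trans\<close>)
      then show "p' x * indicator (centered_ball ?m) x \<le> above s (q' x) * p' x"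
        by (auto simp: E indicator_def)
    qed
    finally show "(\<integral>\<^sup>+x. above s (q' x) * P x \<partial>lborel) \<le> (\<integral>\<^sup>+x. above s (q' x) * p' x \<partial>lborel)" .
  qed
  also have "\<dots> = (\<integral>\<^sup>+x. p' x * q' x \<partial>lborel)"
    by (subst layer_cake[symmetric]) (simp_all add: mult.commute)
  finally show ?thesis .
qed

lemma dominated_conv_indicator:
  fixes f :: "'a::euclidean_space \<Rightarrow> ennreal"
  assumes [measurable]: "f \<in> borel_measurable borel" "W \<in> sets borel"
    and fK: "\<And>x. f x \<le> ennreal K" and f1: "integral\<^sup>N lborel f = 1" and K: "0 < K"
  shows "dominated (conv f (indicator W)) (conv (\<lambda>x. ennreal K * indicator (centered_ball (ennreal (1 / K))) x)
      (indicator (centered_ball (emeasure lborel W))))"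
  unfolding dominated_def
proof
  fix S :: "'a set" assume [measurable]: "S \<in> sets borel"
  define a where "a x = f x / ennreal K" for x
  have [measurable]: "a \<in> borel_measurable borel" unfolding a_def by measurable
  have f: "f x = ennreal K * a x" for x
    using K by (simp add: a_def ennreal_times_divide mult_divide_eq_ennreal mult.commute[of "ennreal K"])
  have a1: "a x \<le> 1" for x
    using fK[of x] K by (simp add: a_def divide_le_posI_ennreal)
  have ia: "integral\<^sup>N lborel a = ennreal (1 / K)"
    using K by (simp add: a_def[abs_def] nn_integral_divide f1 divide_ennreal flip: ennreal_1)
  have indicator_le1: "indicator A x \<le> (1::ennreal)" for A and x :: 'a by (simp add: indicator_def)
  have scale: "riesz (\<lambda>x. ennreal K * g x) h k = ennreal K * riesz g h k"
    if [measurable]: "g \<in> borel_measurable borel" "h \<in> borel_measurable borel" "k \<in> borel_measurable borel"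
    for g h k :: "'a \<Rightarrow> ennreal"
    by (simp add: riesz_def mult.assoc nn_integral_cmult)
  have "(\<integral>\<^sup>+x. conv f (indicator W) x * indicator S x \<partial>lborel) = riesz f (indicator W) (indicator S)"
    by (simp add: riesz_eq_conv)
  also have "\<dots> = ennreal K * riesz a (indicator W) (indicator S)"
    by (simp add: f[abs_def] scale)
  also have "\<dots> \<le> ennreal K * riesz (indicator (centered_ball (ennreal (1 / K))))
      (indicator (centered_ball (emeasure lborel W))) (indicator (centered_ball (emeasure lborel S) :: 'a set))"
    using riesz_rearrangement[of a "indicator W" "indicator S"] a1 indicator_le1
    by (intro mult_left_mono) (simp_all add: ia)
  also have "\<dots> = (\<integral>\<^sup>+x. conv (\<lambda>x. ennreal K * indicator (centered_ball (ennreal (1 / K))) x)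
      (indicator (centered_ball (emeasure lborel W))) x * indicator (centered_ball (emeasure lborel S) :: 'a set) x \<partial>lborel)"
    by (simp add: scale flip: riesz_eq_conv)
  finally show "(\<integral>\<^sup>+x. conv f (indicator W) x * indicator S x \<partial>lborel) \<le> \<dots>" .
qed

text \<open>Convolution with a density bounded by \<open>K\<close> preserves domination if on the dominating side that density is
  replaced by the uniform density on the ball of measure \<open>1 / K\<close>. The indicator of the test set is moved to
  the other side by duality, where the preceding consequence of the Riesz inequality applies.\<close>

lemma dominated_conv:
  fixes f p p' :: "'a::euclidean_space \<Rightarrow> ennreal"
  assumes [measurable]: "f \<in> borel_measurable borel" "p \<in> borel_measurable borel" "p' \<in> borel_measurable borel"
    and fK: "\<And>x. f x \<le> ennreal K" and f1: "integral\<^sup>N lborel f = 1" and K: "0 < K"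
    and p: "dominated p p'" and p': "radial_decreasing p'"
    and fin: "\<And>x. p' x < \<infinity>" "integral\<^sup>N lborel p' < \<infinity>"
  shows "dominated (conv f p) (conv (\<lambda>x. ennreal K * indicator (centered_ball (ennreal (1 / K))) x) p')"
  unfolding dominated_def
proof
  fix W :: "'a set" assume [measurable]: "W \<in> sets borel"
  let ?u = "\<lambda>x::'a. ennreal K * indicator (centered_ball (ennreal (1 / K))) x"
  let ?W = "centered_ball (emeasure lborel W) :: 'a set"
  have u: "radial_decreasing ?u" by (intro radial_decreasing_cmult radial_decreasing_centered_ball)
  have "(\<integral>\<^sup>+x. conv f p x * indicator W x \<partial>lborel) = (\<integral>\<^sup>+y. p y * conv (\<lambda>x. f (- x)) (indicator W) y \<partial>lborel)"
    by (rule nn_integral_conv_mult_shift) measurable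
  also have "\<dots> \<le> (\<integral>\<^sup>+y. p' y * conv ?u (indicator ?W) y \<partial>lborel)"
  proof (rule nn_integral_mult_le_of_dominated)
    show "dominated (conv (\<lambda>x. f (- x)) (indicator W)) (conv ?u (indicator ?W))"
      using nn_integral_lborel_reflect[of f 0] by (intro dominated_conv_indicator) (simp_all add: fK f1 K)
    show "radial_decreasing (conv ?u (indicator ?W))"
      by (intro radial_decreasing_conv u radial_decreasing_centered_ball) measurable
  qed (use assms in simp_all)
  also have "\<dots> = (\<integral>\<^sup>+x. conv ?u p' x * indicator ?W x \<partial>lborel)"
    by (subst nn_integral_conv_mult_shift) (simp_all add: radial_decreasing_uminus[OF u])
  finally show "(\<integral>\<^sup>+x. conv f p x * indicator W x \<partial>lborel) \<le> \<dots>" .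
qed

section \<open>Sums of independent random vectors\<close>

lemma (in prob_space) indep_vars_sum_vector:
  fixes X :: "'i \<Rightarrow> 'a \<Rightarrow> 'b::euclidean_space"
  assumes I: "finite I" "i \<notin> I" and indep: "indep_vars (\<lambda>_. borel) X (insert i I)"
  shows "indep_var borel (X i) borel (\<lambda>\<omega>. \<Sum>i\<in>I. X i \<omega>)"
proof -
  have "indep_var
    borel ((\<lambda>f. f i) \<circ> (\<lambda>\<omega>. restrict (\<lambda>i. X i \<omega>) {i}))
    borel ((\<lambda>f. \<Sum>i\<in>I. f i) \<circ> (\<lambda>\<omega>. restrict (\<lambda>i. X i \<omega>) I))"
    using I by (intro indep_var_compose[OF indep_var_restrict[OF indep]]) auto
  moreover have "((\<lambda>f. f i) \<circ> (\<lambda>\<omega>. restrict (\<lambda>i. X i \<omega>) {i})) = X i" by auto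
  moreover have "((\<lambda>f. \<Sum>i\<in>I. f i) \<circ> (\<lambda>\<omega>. restrict (\<lambda>i. X i \<omega>) I)) = (\<lambda>\<omega>. \<Sum>i\<in>I. X i \<omega>)"
    by (auto cong: rev_conj_cong)
  ultimately show ?thesis by simp
qed

lemma (in prob_space) nn_integral_indep_add:
  fixes X Y :: "'a \<Rightarrow> 'b::euclidean_space"
  assumes indep: "indep_var borel X borel Y" and X: "distributed M lborel X f"
    and p [measurable]: "p \<in> borel_measurable borel"
  shows "(\<integral>\<^sup>+\<omega>. p (X \<omega> + Y \<omega>) \<partial>M) = (\<integral>\<^sup>+\<omega>. conv (\<lambda>x. f (- x)) p (Y \<omega>) \<partial>M)"
proof -
  have [measurable]: "X \<in> borel_measurable M" "Y \<in> borel_measurable M"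
    using indep by (auto dest: indep_var_rv1 indep_var_rv2)
  have [measurable]: "f \<in> borel_measurable borel"
    using X by (simp add: distributed_def)
  have dX: "distr M borel X = density lborel f"
    using X by (simp add: distributed_def cong: distr_cong)
  interpret Y: prob_space "distr M borel Y" by (rule prob_space_distr) measurable
  interpret X: prob_space "distr M borel X" by (rule prob_space_distr) measurable
  interpret XY: pair_prob_space "distr M borel X" "distr M borel Y" ..
  have "(\<integral>\<^sup>+\<omega>. p (X \<omega> + Y \<omega>) \<partial>M) = (\<integral>\<^sup>+z. p (fst z + snd z) \<partial>distr M (borel \<Otimes>\<^sub>M borel) (\<lambda>\<omega>. (X \<omega>, Y \<omega>)))"
    by (subst nn_integral_distr) simp_all
  also have "\<dots> = (\<integral>\<^sup>+z. p (fst z + snd z) \<partial>(distr M borel X \<Otimes>\<^sub>M distr M borel Y))"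
    using indep unfolding indep_var_distribution_eq by simp
  also have "\<dots> = (\<integral>\<^sup>+y. \<integral>\<^sup>+x. p (x + y) \<partial>distr M borel X \<partial>distr M borel Y)"
    by (subst XY.nn_integral_snd[symmetric]) simp_all
  also have "\<dots> = (\<integral>\<^sup>+\<omega>. \<integral>\<^sup>+x. p (x + Y \<omega>) \<partial>distr M borel X \<partial>M)"
    by (subst nn_integral_distr) simp_all
  also have "\<dots> = (\<integral>\<^sup>+\<omega>. conv (\<lambda>x. f (- x)) p (Y \<omega>) \<partial>M)"
  proof (rule nn_integral_cong)
    fix \<omega>
    have "(\<integral>\<^sup>+x. p (x + Y \<omega>) \<partial>distr M borel X) = (\<integral>\<^sup>+x. f x * p (x + Y \<omega>) \<partial>lborel)"
      unfolding dX by (subst nn_integral_density) simp_all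
    also have "\<dots> = conv (\<lambda>x. f (- x)) p (Y \<omega>)"
      unfolding conv_def using nn_integral_lborel_reflect[of "\<lambda>x. f x * p (x + Y \<omega>)" 0]
      by (simp add: add.commute)
    finally show "(\<integral>\<^sup>+x. p (x + Y \<omega>) \<partial>distr M borel X) = conv (\<lambda>x. f (- x)) p (Y \<omega>)" .
  qed
  finally show ?thesis .
qed

text \<open>The induction removes one summand at a time and absorbs its density into the test functions
  \<open>p\<close> and \<open>p'\<close> by convolution, which keeps their relation intact.\<close>

lemma nn_integral_sum_le:
  fixes M :: "'w measure" and N :: "'v measure" and K :: "nat \<Rightarrow> real"
    and X :: "nat \<Rightarrow> 'w \<Rightarrow> 'a::euclidean_space" and U :: "nat \<Rightarrow> 'v \<Rightarrow> 'a"
    and f :: "nat \<Rightarrow> 'a \<Rightarrow> ennreal" and p p' :: "'a \<Rightarrow> ennreal"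
  assumes M: "prob_space M" and N: "prob_space N"
    and "finite I" "I \<noteq> {}" 
    and "prob_space.indep_vars M (\<lambda>_. borel) X I" "prob_space.indep_vars N (\<lambda>_. borel) U I"
    and "\<And>i. i \<in> I \<Longrightarrow> 0 < K i"
    and "\<And>i. i \<in> I \<Longrightarrow> distributed M lborel (X i) (f i)"
    and "\<And>i x. i \<in> I \<Longrightarrow> f i x \<le> ennreal (K i)"
    and "\<And>i. i \<in> I \<Longrightarrow> distributed N lborel (U i)
           (\<lambda>x. ennreal (K i) * indicator (centered_ball (ennreal (1 / K i))) x)"
    and "p \<in> borel_measurable borel" "p' \<in> borel_measurable borel"
    and "dominated p p'" "radial_decreasing p'"
    and "\<And>x. p' x < \<infinity>" "integral\<^sup>N lborel p' < \<infinity>"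
  shows "(\<integral>\<^sup>+\<omega>. p (\<Sum>i\<in>I. X i \<omega>) \<partial>M) \<le> (\<integral>\<^sup>+\<omega>. p' (\<Sum>i\<in>I. U i \<omega>) \<partial>N)"
  using assms(3-)
proof (induction I arbitrary: p p' rule: finite_ne_induct)
  case (singleton i)
  let ?u = "\<lambda>x::'a. ennreal (K i) * indicator (centered_ball (ennreal (1 / K i))) x"
  have X: "distributed M lborel (X i) (f i)" and U: "distributed N lborel (U i) ?u"
    using singleton.prems by auto
  note [measurable] = singleton.prems(7,8)
  have fm [measurable]: "f i \<in> borel_measurable borel"
    using X by (simp add: distributed_def)
  have K: "0 < K i" using singleton.prems by simp
  have f1: "integral\<^sup>N lborel (f i) = 1"
    using distributed_nn_integral[OF X, of "\<lambda>_. 1"] prob_space.emeasure_space_1[OF M] by simp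
  have "(\<integral>\<^sup>+\<omega>. p (X i \<omega>) \<partial>M) = (\<integral>\<^sup>+x. p x * f i x \<partial>lborel)"
    using distributed_nn_integral[OF X, of p] by (simp add: mult.commute)
  also have "\<dots> \<le> (\<integral>\<^sup>+x. p' x * ?u x \<partial>lborel)"
  proof (rule nn_integral_mult_le_of_dominated)
    show "dominated (f i) ?u"
      using singleton.prems(5) K f1 by (intro dominated_bounded_density) auto
    show "radial_decreasing ?u"
      by (intro radial_decreasing_cmult radial_decreasing_centered_ball)
  qed (use singleton.prems in \<open>simp_all add: fm\<close>)
  also have "\<dots> = (\<integral>\<^sup>+\<omega>. p' (U i \<omega>) \<partial>N)"
    using distributed_nn_integral[OF U, of p'] by (simp add: mult.commute)
  finally show ?case by simp
next
  case (insert i F)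
  let ?u = "\<lambda>x::'a. ennreal (K i) * indicator (centered_ball (ennreal (1 / K i))) x"
  have X: "distributed M lborel (X i) (f i)" and U: "distributed N lborel (U i) ?u"
    using insert.prems by auto
  note [measurable] = insert.prems(7,8)
  have [measurable]: "f i \<in> borel_measurable borel"
    using X by (simp add: distributed_def)
  have K: "0 < K i" using insert.prems by simp
  have f1: "(\<integral>\<^sup>+x. f i (- x) \<partial>lborel) = 1"
    using distributed_nn_integral[OF X, of "\<lambda>_. 1"] prob_space.emeasure_space_1[OF M]
      nn_integral_lborel_reflect[of "f i" 0] by simp
  have u: "radial_decreasing ?u"
    by (intro radial_decreasing_cmult radial_decreasing_centered_ball)
  have iu: "integral\<^sup>N lborel ?u = 1"
    using K by (simp add: nn_integral_cmult_indicator flip: ennreal_mult)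
  have "prob_space.indep_var M borel (X i) borel (\<lambda>\<omega>. \<Sum>i\<in>F. X i \<omega>)"
    by (rule prob_space.indep_vars_sum_vector[OF M]) (use insert in auto)
  note split_X = prob_space.nn_integral_indep_add[OF M this X]
  have "prob_space.indep_var N borel (U i) borel (\<lambda>\<omega>. \<Sum>i\<in>F. U i \<omega>)"
    by (rule prob_space.indep_vars_sum_vector[OF N]) (use insert in auto)
  note split_U = prob_space.nn_integral_indep_add[OF N this U]
  have "(\<integral>\<^sup>+\<omega>. p (\<Sum>i\<in>insert i F. X i \<omega>) \<partial>M) = (\<integral>\<^sup>+\<omega>. conv (\<lambda>x. f i (- x)) p (\<Sum>i\<in>F. X i \<omega>) \<partial>M)"
    using split_X[of p] insert by simp
  also have "\<dots> \<le> (\<integral>\<^sup>+\<omega>. conv ?u p' (\<Sum>i\<in>F. U i \<omega>) \<partial>N)"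
  proof (rule insert.IH)
    show "dominated (conv (\<lambda>x. f i (- x)) p) (conv ?u p')"
      using insert.prems K f1 by (intro dominated_conv) auto
    show "radial_decreasing (conv ?u p')"
      using insert.prems u by (intro radial_decreasing_conv) auto
    show "integral\<^sup>N lborel (conv ?u p') < \<infinity>"
      using insert.prems(12) by (subst nn_integral_conv) (simp_all add: iu)
    show "conv ?u p' x < \<infinity>" for x
    proof -
      have "conv ?u p' x \<le> (\<integral>\<^sup>+y. ennreal (K i) * p' (x - y) \<partial>lborel)"
        unfolding conv_def by (intro nn_integral_mono mult_right_mono) (auto simp: indicator_def)
      also have "\<dots> = ennreal (K i) * integral\<^sup>N lborel p'"
        by (simp add: nn_integral_cmult nn_integral_lborel_reflect)
      also have "\<dots> < \<infinity>" using insert.prems(12) by (simp add: ennreal_mult_less_top)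
      finally show ?thesis .
    qed
    show "prob_space.indep_vars M (\<lambda>_. borel) X F" "prob_space.indep_vars N (\<lambda>_. borel) U F"
      using insert.prems(1,2) prob_space.indep_vars_subset[OF M] prob_space.indep_vars_subset[OF N] by blast+
  qed (use insert.prems in \<open>auto intro: measurable_conv\<close>)
  also have "\<dots> = (\<integral>\<^sup>+\<omega>. p' (\<Sum>i\<in>insert i F. U i \<omega>) \<partial>N)"
    using split_U[of p'] insert radial_decreasing_uminus[OF u] by simp
  finally show ?case .
qed

text \<open>The density is bounded almost everywhere; truncating it at \<open>K\<close> makes the bound hold everywhere.\<close>

lemma (in prob_space) bounded_density_of_max_density:
  fixes X :: "'a \<Rightarrow> 'b::euclidean_space"
  assumes [measurable]: "X \<in> borel_measurable M" and le: "max_density M X \<le> ennreal K"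
  obtains f where "distributed M lborel X f" "\<And>x. f x \<le> ennreal K"
proof -
  let ?D = "distr M lborel X"
  have ac: "absolutely_continuous lborel ?D"
    using le by (auto simp: max_density_def top_unique split: if_splits)
  define g where "g = RN_deriv lborel ?D"
  have [measurable]: "g \<in> borel_measurable lborel" by (simp add: g_def)
  have g: "density lborel g = ?D"
    unfolding g_def by (rule sigma_finite_measure.density_RN_deriv[OF sigma_finite_lborel ac]) simp
  have sup: "ess_sup_density g \<le> ennreal K"
    using le ac by (simp add: max_density_def g_def)
  have "AE x in lborel. g x \<le> ennreal K + ennreal (1 / real (Suc n))" for n
  proof -
    let ?e = "ennreal K + ennreal (1 / real (Suc n))"
    \<comment> \<open>a height strictly above the supremum defining \<open>ess_sup_density\<close> is exceeded only on a null set\<close>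
    have "ess_sup_density g < ?e"
      using ennreal_add_left_cancel_less[of "ennreal K" 0 "ennreal (1 / real (Suc n))"]
      by (intro le_less_trans[OF sup]) simp
    moreover have "?e \<le> ess_sup_density g" if "0 < emeasure lborel {t. g t > ?e}"
      using that unfolding ess_sup_density_def by (intro Sup_upper) simp
    ultimately have "emeasure lborel {t. g t > ?e} = 0"
      by (metis leD zero_less_iff_neq_zero)
    moreover have "{t \<in> space lborel. g t > ?e} \<in> sets lborel" by measurable
    ultimately show ?thesis
      by (intro AE_I[of _ _ "{t. g t > ?e}"]) (auto simp: not_le)
  qed
  then have "AE x in lborel. \<forall>n. g x \<le> ennreal K + ennreal (1 / real (Suc n))"
    by (simp add: AE_all_countable)
  then have ae: "AE x in lborel. g x = min (g x) (ennreal K)"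
  proof eventually_elim
    case (elim x)
    have "g x \<le> ennreal K"
    proof (rule ennreal_le_epsilon)
      fix e :: real assume "0 < e"
      then obtain n where "1 / real (Suc n) < e" using nat_approx_posE by blast
      then have "ennreal K + ennreal (1 / real (Suc n)) \<le> ennreal K + ennreal e"
        by (intro add_left_mono ennreal_leI) simp
      then show "g x \<le> ennreal K + ennreal e" using elim order_trans by blast
    qed
    then show ?case by simp
  qed
  have "distributed M lborel X (\<lambda>x. min (g x) (ennreal K))"
    unfolding distributed_def using g ae
    by (auto simp: density_cong[of g lborel "\<lambda>x. min (g x) (ennreal K)"])
  then show ?thesis by (rule that) simp
qed

lemma lebesgue_measurable_borel_superset:
  fixes S :: "'a::euclidean_space set"
  assumes "S \<in> sets lebesgue"
  obtains T where "T \<in> sets borel" "S \<subseteq> T" "emeasure lborel T = emeasure lebesgue S"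
proof -
  obtain S0 Z Z' where S: "S = S0 \<union> Z" "Z \<subseteq> Z'" "Z' \<in> null_sets lborel" "S0 \<in> sets lborel"
    using assms by (rule sets_completionE)
  have "emeasure lborel (S0 \<union> Z') = emeasure lborel S0"
    using S by (simp add: emeasure_Un_null_set)
  moreover have "emeasure lebesgue S0 \<le> emeasure lebesgue S"
    using S assms by (intro emeasure_mono) auto
  moreover have "emeasure lebesgue S \<le> emeasure lebesgue (S0 \<union> Z')"
    using S by (intro emeasure_mono) auto
  ultimately show ?thesis
    using S by (intro that[of "S0 \<union> Z'"]) (auto simp: null_setsD2 intro!: antisym)
qed

lemma ball_eq_centered_ball:
  assumes "emeasure lborel (ball (0::'a::euclidean_space) r) = m"
  shows "ball (0::'a) r = centered_ball m"
proof (cases "0 \<le> r")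
  case True
  then show ?thesis using centered_ball_eq_ball[where 'a='a, of m r] assms by simp
next
  case False
  then have "ball (0::'a) r = {}" by simp
  with assms show ?thesis by (metis centered_ball_0 emeasure_empty)
qed

theorem theorem1:
  fixes M :: "'w measure" and N :: "'v measure"
    and n :: nat
    and K r :: "nat \<Rightarrow> real"
    and X :: "nat \<Rightarrow> 'w \<Rightarrow> real ^ 'd"
    and U :: "nat \<Rightarrow> 'v \<Rightarrow> real ^ 'd"
    and S B :: "(real ^ 'd) set"
  assumes "prob_space M" and "prob_space N"
    and "n \<ge> 1"
    and "\<And>i. i \<in> {1..n} \<Longrightarrow> K i > 0"
    and "prob_space.indep_vars M (\<lambda>_. borel) X {1..n}"
    and "\<And>i. i \<in> {1..n} \<Longrightarrow> max_density M (X i) \<le> ennreal (K i)"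
    and "prob_space.indep_vars N (\<lambda>_. borel) U {1..n}"
    and "\<And>i. i \<in> {1..n} \<Longrightarrow>
           distributed N lborel (U i) (\<lambda>x. ennreal (K i) * indicator (ball 0 (r i)) x)"
    and "S \<in> sets lebesgue"
    and "if emeasure lebesgue S = \<infinity> then B = UNIV
         else (\<exists>\<rho>. B = ball 0 \<rho>) \<and> emeasure lebesgue B = emeasure lebesgue S"
  shows "\<P>(\<omega> in completion M. (\<Sum>i\<in>{1..n}. X i \<omega>) \<in> S)
           \<le> \<P>(\<omega> in N. (\<Sum>i\<in>{1..n}. U i \<omega>) \<in> B)"
proof -
  interpret M: prob_space M by fact
  interpret N: prob_space N by fact
  obtain T where T [measurable]: "T \<in> sets borel" and ST: "S \<subseteq> T"
    and T_eq: "emeasure lborel T = emeasure lebesgue S"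
    using assms(9) by (rule lebesgue_measurable_borel_superset)
  have X [measurable]: "X i \<in> borel_measurable M" if "i \<in> {1..n}" for i
    using assms(5) that by (auto simp: M.indep_vars_def)
  have U [measurable]: "U i \<in> borel_measurable N" if "i \<in> {1..n}" for i
    using assms(7) that by (auto simp: N.indep_vars_def)
  have [measurable]: "(\<lambda>\<omega>. \<Sum>i\<in>{1..n}. X i \<omega>) \<in> borel_measurable M"
    "(\<lambda>\<omega>. \<Sum>i\<in>{1..n}. U i \<omega>) \<in> borel_measurable N"
    by (auto intro!: borel_measurable_sum X U)
  let ?LX = "{\<omega> \<in> space M. (\<Sum>i\<in>{1..n}. X i \<omega>) \<in> T}"
  let ?LU = "{\<omega> \<in> space N. (\<Sum>i\<in>{1..n}. U i \<omega>) \<in> B}"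
  have LX: "?LX \<in> sets M" by measurable
  have B_borel [measurable]: "B \<in> sets borel"
    using assms(10) by (auto split: if_splits)
  have LU: "?LU \<in> sets N" by measurable
  \<comment> \<open>monotonicity only needs the larger event to be measurable\<close>
  have "emeasure (completion M) {\<omega> \<in> space M. (\<Sum>i\<in>{1..n}. X i \<omega>) \<in> S} \<le> emeasure (completion M) ?LX"
    using ST by (intro emeasure_mono) auto
  also have "\<dots> = emeasure M ?LX" using LX by simp
  also have "\<dots> \<le> emeasure N ?LU"
  proof (cases "emeasure lebesgue S = \<infinity>")
    case True
    then have "B = UNIV" using assms(10) by simp
    then show ?thesis by (simp add: N.emeasure_space_1 M.emeasure_le_1)
  next
    case False
    let ?m = "emeasure lborel T"
    have "emeasure lborel B = ?m" using assms(10) False T_eq by simp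
    moreover obtain \<rho> where "B = ball 0 \<rho>" using assms(10) False by auto
    ultimately have B: "B = centered_ball ?m" using ball_eq_centered_ball by blast
    have "\<forall>i\<in>{1..n}. \<exists>f. distributed M lborel (X i) f \<and> (\<forall>x. f x \<le> ennreal (K i))"
      using M.bounded_density_of_max_density[OF X assms(6)] by metis
    then obtain f where f: "\<And>i. i \<in> {1..n} \<Longrightarrow> distributed M lborel (X i) (f i)"
      "\<And>i x. i \<in> {1..n} \<Longrightarrow> f i x \<le> ennreal (K i)" by metis
    have u: "distributed N lborel (U i) (\<lambda>x. ennreal (K i) * indicator (centered_ball (ennreal (1 / K i))) x)"
      if i: "i \<in> {1..n}" for i
    proof -
      have "ennreal (K i) * emeasure lborel (ball (0 :: real ^ 'd) (r i)) = 1"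
        using distributed_nn_integral[OF assms(8)[OF i], of "\<lambda>_. 1"]
        by (simp add: nn_integral_cmult_indicator N.emeasure_space_1)
      moreover have "ennreal (1 / K i) * ennreal (K i) = 1"
        using assms(4)[OF i] by (simp flip: ennreal_mult)
      ultimately have "emeasure lborel (ball (0 :: real ^ 'd) (r i)) = ennreal (1 / K i)"
        by (metis mult.assoc mult.left_neutral mult.right_neutral)
      from ball_eq_centered_ball[OF this] assms(8)[OF i] show ?thesis by simp
    qed
    have "emeasure M ?LX = (\<integral>\<^sup>+\<omega>. indicator T (\<Sum>i\<in>{1..n}. X i \<omega>) \<partial>M)"
      using LX by (subst nn_integral_indicator[symmetric]) (auto intro!: nn_integral_cong simp: indicator_def simp del: nn_integral_indicator)
    also have "\<dots> \<le> (\<integral>\<^sup>+\<omega>. indicator B (\<Sum>i\<in>{1..n}. U i \<omega>) \<partial>N)"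
      unfolding B
    proof (rule nn_integral_sum_le[where K=K and f=f])
      show "integral\<^sup>N lborel (indicator (centered_ball ?m :: (real ^ 'd) set)) < \<infinity>"
        using False T_eq by (simp add: less_top)
      show "indicator (centered_ball ?m) x < (\<infinity>::ennreal)" for x :: "real ^ 'd"
        by (simp add: indicator_def)
    qed (use assms f u in \<open>auto intro: dominated_indicator radial_decreasing_centered_ball\<close>)
    also have "\<dots> = emeasure N ?LU"
      using LU by (subst nn_integral_indicator[symmetric]) (auto intro!: nn_integral_cong simp: indicator_def simp del: nn_integral_indicator)
    finally show ?thesis .
  qed
  finally show ?thesis
    unfolding measure_def space_completion by (rule enn2real_mono) (simp add: less_top[symmetric])
qed

end
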